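(* Let $\Sigma=\partial\Omega\subset\mathbb{R}^3$ be a static scene, let a camera move inside $\Omega$ with linear velocity $v(t)$ and angular velocity $\omega(t)$, and let $D(t,\eta)$, $\Gamma(t,\eta)=1/D(t,\eta)$ ($t\ge 0$, $\eta\in\mathbb{S}^2$) be the associated depth and inverse depth fields, all as defined in the context. Assume that there exist $\bar v>0$, $\bar\omega>0$, $\bar\gamma>0$ and $\bar\Gamma>0$ such that $$\forall t\ge 0,\ \forall\eta\in\mathbb{S}^2,\quad |v(t)|\le\bar v,\quad |\omega(t)|\le\bar\omega,\quad \bar\gamma\le\Gamma(t,\eta)\le\bar\Gamma .$$ Let $k>0$ and consider the observer $$\frac{\partial\widehat D}{\partial t}=-\nabla\widehat D\cdot\big(f_t+\Gamma g_t\big)-v\cdot\eta+k\,\big(1-\widehat D\,\Gamma\big)$$ on $\mathbb{S}^2$ (that is, the depth observer fed with an inverse depth estimate that coincides with the true inverse depth $\Gamma$), where $f_t(\eta)=\eta\times\omega(t)$ and $g_t(\eta)=\eta\times(\eta\times v(t))$, with an initial condition $\widehat D(0,\eta)$ that is $C^1$ with respect to $\eta$. Then for all $t\ge 0$ the solution $\widehat D(t,\eta)$ exists, is unique, remains $C^1$ with respect to $\eta$, and $$\|\widehat D(t,\cdot)-D(t,\cdot)\|_{L^\infty}\le e^{-k\bar\gamma t}\,\|\widehat D(0,\cdot)-D(0,\cdot)\|_{L^\infty},$$ where $\|h\|_{L^\infty}=\max_{\eta\in\mathbb{S}^2}|h(\eta)|$.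
   Context: Scene and camera. $\Sigma\subset\mathbb{R}^3$ is a closed, $C^1$, convex surface, diffeomorphic to the unit sphere $\mathbb{S}^2$, and $\Omega$ is the domain it delimits, $\Sigma=\partial\Omega$. The scene is static. A camera with optical center $C(t)\in\Omega$ (expressed in a fixed reference frame) and orientation given by a unit quaternion $q(t)$ moves inside $\Omega$ for $t\ge 0$: identifying vectors of $\mathbb{R}^3$ with imaginary quaternions, a vector $\varsigma$ in the camera frame corresponds to the vector $q\varsigma q^*$ in the reference frame ($q^*$ is the conjugate of $q$). The linear and angular velocities $v(t),\omega(t)\in\mathbb{R}^3$ are expressed in the camera frame, so $\frac{d}{dt}C=q v q^*$ and $\frac{d}{dt}q=\frac12 q\omega$; $v$ and $\omega$ are continuous functions of $t$. Depth. For $\eta\in\mathbb{S}^2$ (a unit vector in the camera frame, i.e. a pixel), there is exactly one point $M\in\Sigma$ seen from $C(t)$ in direction $\eta$, i.e. with $q(t)\eta q(t)^*=\overrightarrow{C(t)M}/\|\overrightarrow{C(t)M}\|$. The depth $D(t,\eta)$ is the distance $\|\overrightarrow{C(t)M}\|$, and $\Gamma(t,\eta)=1/D(t,\eta)$. Notation. $\nabla h$ is the gradient of a scalar field $h$ on $\mathbb{S}^2$ for the standard Riemannian metric, viewed at each $\eta$ as a vector of $\mathbb{R}^3$ tangent to the sphere at $\eta$; $a\cdot b$ and $a\times b$ are the Euclidean scalar product and cross product in $\mathbb{R}^3$. The solution of the observer equation is understood in the classical sense. *)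

theory Defs
  imports "HOL-Analysis.Analysis"
begin

section \<open>Maps of class C1 between subsets of Euclidean spaces\<close>

text \<open>A map on an arbitrary subset \<open>S\<close> is of class C1 if near each point of \<open>S\<close> it is the
  restriction of a C1 map defined on an open set of the ambient space. For embedded C1 submanifolds
  (such as the sphere) this is the usual notion of a C1 map.\<close>

definition C1_on :: "'a::euclidean_space set \<Rightarrow> ('a \<Rightarrow> 'b::euclidean_space) \<Rightarrow> bool" where
  "C1_on S f \<longleftrightarrow>
     (\<forall>x\<in>S. \<exists>U F (F' :: 'a \<Rightarrow> 'a \<Rightarrow>\<^sub>L 'b).
        open U \<and> x \<in> U \<and> (\<forall>y\<in>U. (F has_derivative blinfun_apply (F' y)) (at y)) \<and>
        continuous_on U F' \<and> (\<forall>y\<in>U \<inter> S. F y = f y))"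

definition C1_diffeomorphic ::
    "'a::euclidean_space set \<Rightarrow> 'b::euclidean_space set \<Rightarrow> bool" where
  "C1_diffeomorphic S T \<longleftrightarrow> (\<exists>f g. homeomorphism S T f g \<and> C1_on S f \<and> C1_on T g)"

definition C1_surface :: "(real^3) set \<Rightarrow> bool" where
  "C1_surface S \<longleftrightarrow>
     (\<forall>p\<in>S. \<exists>W (V :: (real^2) set).
        open W \<and> p \<in> W \<and> open V \<and> C1_diffeomorphic V (S \<inter> W))"


section \<open>Quaternions and rotations\<close>

text \<open>A quaternion is a pair (real part, imaginary part); the product type carries the
  Euclidean norm of \<open>\<real>\<^sup>4\<close>.\<close>

type_synonym quaternion = "real \<times> (real^3)"

definition qmult :: "quaternion \<Rightarrow> quaternion \<Rightarrow> quaternion" where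
  "qmult p q = (fst p * fst q - snd p \<bullet> snd q,
                fst p *\<^sub>R snd q + fst q *\<^sub>R snd p + cross3 (snd p) (snd q))"

definition qconj :: "quaternion \<Rightarrow> quaternion" where
  "qconj q = (fst q, - snd q)"

definition qim :: "real^3 \<Rightarrow> quaternion" where
  "qim u = (0, u)"

text \<open>The real part of \<open>q u q*\<close> vanishes, so \<open>snd\<close> is the identification of an imaginary
  quaternion with a vector.\<close>

definition qrot :: "quaternion \<Rightarrow> real^3 \<Rightarrow> real^3" where
  "qrot q u = snd (qmult (qmult q (qim u)) (qconj q))"


section \<open>Scene, camera and depth\<close>

definition convex_scene :: "(real^3) set \<Rightarrow> (real^3) set \<Rightarrow> bool" where
  "convex_scene \<Omega> S \<longleftrightarrow>
     open \<Omega> \<and> bounded \<Omega> \<and> convex \<Omega> \<and> \<Omega> \<noteq> {} \<and> S = frontier \<Omega> \<and>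
     compact S \<and> C1_surface S \<and> C1_diffeomorphic (sphere (0::real^3) 1) S"

definition camera_motion ::
    "(real^3) set \<Rightarrow> (real \<Rightarrow> real^3) \<Rightarrow> (real \<Rightarrow> quaternion) \<Rightarrow>
     (real \<Rightarrow> real^3) \<Rightarrow> (real \<Rightarrow> real^3) \<Rightarrow> bool" where
  "camera_motion \<Omega> C q v \<omega> \<longleftrightarrow>
     continuous_on {0..} v \<and> continuous_on {0..} \<omega> \<and>
     (\<forall>t\<ge>0. C t \<in> \<Omega> \<and> norm (q t) = 1 \<and>
        (C has_vector_derivative qrot (q t) (v t)) (at t within {0..}) \<and>
        (q has_vector_derivative (1/2) *\<^sub>R qmult (q t) (qim (\<omega> t))) (at t within {0..}))"

definition seen_point :: "(real^3) set \<Rightarrow> real^3 \<Rightarrow> quaternion \<Rightarrow> real^3 \<Rightarrow> real^3" where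
  "seen_point S c p \<eta> = (THE M. M \<in> S \<and> qrot p \<eta> = (M - c) /\<^sub>R norm (M - c))"

definition depth ::
    "(real^3) set \<Rightarrow> (real \<Rightarrow> real^3) \<Rightarrow> (real \<Rightarrow> quaternion) \<Rightarrow> real \<Rightarrow> real^3 \<Rightarrow> real" where
  "depth S C q t \<eta> = norm (seen_point S (C t) (q t) \<eta> - C t)"

definition inv_depth ::
    "(real^3) set \<Rightarrow> (real \<Rightarrow> real^3) \<Rightarrow> (real \<Rightarrow> quaternion) \<Rightarrow> real \<Rightarrow> real^3 \<Rightarrow> real" where
  "inv_depth S C q t \<eta> = 1 / depth S C q t \<eta>"


section \<open>Scalar fields on the unit sphere\<close>

text \<open>\<open>g\<close> is the Riemannian gradient of \<open>h\<close> at \<open>\<eta>\<close>: it is tangent to the sphere and represents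
  the differential of \<open>h\<close> along the sphere. Only the values of \<open>h\<close> on the sphere matter.\<close>

definition has_sphere_gradient :: "(real^3 \<Rightarrow> real) \<Rightarrow> real^3 \<Rightarrow> real^3 \<Rightarrow> bool" where
  "has_sphere_gradient h g \<eta> \<longleftrightarrow>
     g \<bullet> \<eta> = 0 \<and> (h has_derivative (\<lambda>x. g \<bullet> x)) (at \<eta> within sphere 0 1)"

definition sphere_gradient :: "(real^3 \<Rightarrow> real) \<Rightarrow> real^3 \<Rightarrow> real^3" where
  "sphere_gradient h \<eta> = (THE g. has_sphere_gradient h g \<eta>)"

text \<open>The supremum is a maximum whenever \<open>h\<close> is continuous on the sphere.\<close>

definition sphere_norm_inf :: "(real^3 \<Rightarrow> real) \<Rightarrow> real" where
  "sphere_norm_inf h = (SUP \<eta>\<in>sphere 0 1. \<bar>h \<eta>\<bar>)"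


section \<open>The depth observer\<close>

definition flow_f :: "(real \<Rightarrow> real^3) \<Rightarrow> real \<Rightarrow> real^3 \<Rightarrow> real^3" where
  "flow_f \<omega> t \<eta> = cross3 \<eta> (\<omega> t)"

definition flow_g :: "(real \<Rightarrow> real^3) \<Rightarrow> real \<Rightarrow> real^3 \<Rightarrow> real^3" where
  "flow_g v t \<eta> = cross3 \<eta> (cross3 \<eta> (v t))"

text \<open>Solutions on the whole time interval: all derivatives exist and the equation holds at every
  point, with a one-sided time derivative at \<open>t = 0\<close>. Continuity of the derivatives is not
  required.\<close>

definition depth_observer_solution ::
    "real \<Rightarrow> (real \<Rightarrow> real^3) \<Rightarrow> (real \<Rightarrow> real^3) \<Rightarrow> (real \<Rightarrow> real^3 \<Rightarrow> real) \<Rightarrow>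
     (real^3 \<Rightarrow> real) \<Rightarrow> (real \<Rightarrow> real^3 \<Rightarrow> real) \<Rightarrow> bool" where
  "depth_observer_solution k v \<omega> \<Gamma> D0 Dh \<longleftrightarrow>
     continuous_on ({0..} \<times> sphere 0 1) (\<lambda>(t, \<eta>). Dh t \<eta>) \<and>
     (\<forall>\<eta>\<in>sphere 0 1. Dh 0 \<eta> = D0 \<eta>) \<and>
     (\<forall>t\<ge>0. \<forall>\<eta>\<in>sphere 0 1.
        (\<exists>g. has_sphere_gradient (Dh t) g \<eta>) \<and>
        ((\<lambda>s. Dh s \<eta>) has_real_derivative
           - (sphere_gradient (Dh t) \<eta> \<bullet> (flow_f \<omega> t \<eta> + \<Gamma> t \<eta> *\<^sub>R flow_g v t \<eta>))
           - v t \<bullet> \<eta> + k * (1 - Dh t \<eta> * \<Gamma> t \<eta>)) (at t within {0..}))"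

end

theory Submission
  imports Defs
begin

text \<open>In the image, a fixed scene point \<open>M \<in> S\<close> moves along the characteristics of the observer
  equation: \<open>q\<^sup>* (M - C) q / |M - C|\<close> has velocity \<open>f + \<Gamma> g\<close>. Along such a curve the true depth
  \<open>|M - C|\<close> solves the equation and the error \<open>e\<close> satisfies \<open>e' = - k e / |M - C|\<close>, so that the solution is
  explicit:
  \<open>|M - C t| + e\<^sub>0 M * exp (- k \<integral>\<^sub>0\<^sup>t ds / |M - C s|)\<close>, with \<open>M\<close> the point seen at time \<open>t\<close> in direction
  \<open>\<eta>\<close>. Differentiability reduces to that of the exit point of a ray from the convex domain, which follows
  from the existence of a unique, hence continuous, supporting normal at each boundary point. Uniqueness
  holds without continuity of the derivatives, by a maximum principle for the difference of two solutions.\<close>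

section \<open>Maps of class C1 relative to a set\<close>

text \<open>Since the scene is static, the boundary point M is a coordinate in which the transport
  term vanishes: for each M the equation becomes a linear ODE in time, and no flow has to be solved
  for. The price is the return from M to \<open>\<eta>\<close>: the formula is a classical solution
  only once the point seen at time t in direction \<open>\<eta>\<close> is known to be C1 in (t,
  \<open>\<eta>\<close>), for a boundary that is merely C1. All fields are extended to nonzero
  directions, constant along rays. Their ambient derivative then annihilates the radial direction
  and restricts to the gradient on the sphere, and test curves may leave the sphere. Derivatives at
  t = 0 are one-sided, hence a notion of C1 relative to a set that is not open. The number 1 / |M -
  C s| is the inverse depth at whichever pixel shows M at time s, so bounds uniform over pixels hold
  along the whole orbit of M: \<open>\<gamma>bar\<close> makes the integral at least
  \<open>\<gamma>bar * t\<close>, and \<open>\<Gamma>bar\<close> keeps its integrand away from the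
  singularity at M = C s.\<close>

definition C1_within :: "'a::euclidean_space set \<Rightarrow> ('a \<Rightarrow> 'b::euclidean_space) \<Rightarrow> bool" where
  "C1_within X f \<longleftrightarrow>
     (\<exists>f' :: 'a \<Rightarrow> 'a \<Rightarrow>\<^sub>L 'b.
        (\<forall>x\<in>X. (f has_derivative blinfun_apply (f' x)) (at x within X)) \<and> continuous_on X f')"

text \<open>In finite dimension, continuity of the derivative in operator norm reduces to continuity
  in each fixed direction, so derivatives can be given as plain functions.\<close>

lemma C1_withinI:
  fixes f :: "'a::euclidean_space \<Rightarrow> 'b::euclidean_space"
  assumes "\<And>x. x \<in> X \<Longrightarrow> (f has_derivative f' x) (at x within X)"
    and "\<And>h. continuous_on X (\<lambda>x. f' x h)"
  shows "C1_within X f"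
proof -
  have app: "blinfun_apply (Blinfun (f' x)) = f' x" if "x \<in> X" for x
    using assms(1)[OF that] by (simp add: bounded_linear_Blinfun_apply has_derivative_bounded_linear)
  have "continuous_on X (\<lambda>x. Blinfun (f' x))"
    by (rule continuous_on_blinfun_componentwise) (simp add: app assms(2) cong: continuous_on_cong)
  then show ?thesis
    unfolding C1_within_def using assms(1) app by (intro exI[of _ "\<lambda>x. Blinfun (f' x)"]) simp
qed

lemma C1_withinE:
  assumes "C1_within X f"
  obtains f' where "\<And>x. x \<in> X \<Longrightarrow> (f has_derivative f' x) (at x within X)"
    and "\<And>h. continuous_on X (\<lambda>x. f' x h)"
proof -
  obtain F where F: "\<forall>x\<in>X. (f has_derivative blinfun_apply (F x)) (at x within X)" "continuous_on X F"
    using assms unfolding C1_within_def by blast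
  show thesis
    by (rule that[of "\<lambda>x. blinfun_apply (F x)"]) (use F in \<open>auto intro!: continuous_intros\<close>)
qed

lemma C1_within_continuous_on: "C1_within X f \<Longrightarrow> continuous_on X f"
  unfolding C1_within_def
  by (auto simp: continuous_on_eq_continuous_within intro: has_derivative_continuous)

lemma C1_within_subset: "C1_within X f \<Longrightarrow> Y \<subseteq> X \<Longrightarrow> C1_within Y f"
  unfolding C1_within_def by (meson continuous_on_subset has_derivative_subset subsetD)

lemma C1_within_cong:
  assumes "C1_within X f" "\<And>x. x \<in> X \<Longrightarrow> f x = g x"
  shows "C1_within X g"
proof -
  have "(g has_derivative D) (at x within X)"
    if "x \<in> X" "(f has_derivative D) (at x within X)" for x D
    by (rule has_derivative_transform_within[OF that(2) zero_less_one that(1)]) (simp add: assms(2))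
  then show ?thesis using assms(1) unfolding C1_within_def by metis
qed

lemma C1_within_compose:
  assumes f: "C1_within X f" and g: "C1_within Y g" and "f ` X \<subseteq> Y"
  shows "C1_within X (\<lambda>x. g (f x))"
proof -
  obtain f' where f': "\<forall>x\<in>X. (f has_derivative blinfun_apply (f' x)) (at x within X)" "continuous_on X f'"
    using f unfolding C1_within_def by blast
  obtain g' where g': "\<forall>x\<in>Y. (g has_derivative blinfun_apply (g' x)) (at x within Y)" "continuous_on Y g'"
    using g unfolding C1_within_def by blast
  have "((\<lambda>x. g (f x)) has_derivative blinfun_apply (g' (f x) o\<^sub>L f' x)) (at x within X)" if "x \<in> X" for x
  proof -
    have "((\<lambda>x. g (f x)) has_derivative (\<lambda>h. blinfun_apply (g' (f x)) (blinfun_apply (f' x) h))) (at x within X)"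
      by (rule has_derivative_in_compose2[OF _ assms(3) that])
        (use f'(1) g'(1) that in simp_all)
    then show ?thesis by (simp add: blinfun_compose.rep_eq comp_def)
  qed
  moreover have "continuous_on X (\<lambda>x. g' (f x) o\<^sub>L f' x)"
    by (rule bounded_bilinear.continuous_on[OF bounded_bilinear_blinfun_compose
          continuous_on_compose2[OF g'(2) C1_within_continuous_on[OF f] assms(3)] f'(2)])
  ultimately show ?thesis unfolding C1_within_def
    by (intro exI[of _ "\<lambda>x. g' (f x) o\<^sub>L f' x"] conjI ballI)
qed

lemma C1_within_bounded_linear: "bounded_linear f \<Longrightarrow> C1_within X f"
  by (rule C1_withinI[of X f "\<lambda>_. f"]) (auto intro: bounded_linear_imp_has_derivative)

lemma C1_within_const: "C1_within X (\<lambda>_. c)"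
  by (rule C1_withinI[of X _ "\<lambda>_ _. 0"]) auto

lemma C1_within_bilinear:
  assumes b: "bounded_bilinear b" and f: "C1_within X f" and g: "C1_within X g"
  shows "C1_within X (\<lambda>x. b (f x) (g x))"
proof -
  obtain f' where f': "\<And>x. x \<in> X \<Longrightarrow> (f has_derivative f' x) (at x within X)"
      "\<And>h. continuous_on X (\<lambda>x. f' x h)"
    using C1_withinE[OF f] by metis
  obtain g' where g': "\<And>x. x \<in> X \<Longrightarrow> (g has_derivative g' x) (at x within X)"
      "\<And>h. continuous_on X (\<lambda>x. g' x h)"
    using C1_withinE[OF g] by metis
  show ?thesis
    by (rule C1_withinI[of X _ "\<lambda>x h. b (f x) (g' x h) + b (f' x h) (g x)"])
      (intro bounded_bilinear.FDERIV[OF b] f'(1) g'(1) continuous_on_add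
        bounded_bilinear.continuous_on[OF b] f'(2) g'(2) C1_within_continuous_on[OF f]
        C1_within_continuous_on[OF g]; assumption)+
qed

lemma C1_within_add:
  assumes f: "C1_within X f" and g: "C1_within X g"
  shows "C1_within X (\<lambda>x. f x + g x)"
proof -
  obtain f' where f': "\<And>x. x \<in> X \<Longrightarrow> (f has_derivative f' x) (at x within X)"
      "\<And>h. continuous_on X (\<lambda>x. f' x h)"
    using C1_withinE[OF f] by metis
  obtain g' where g': "\<And>x. x \<in> X \<Longrightarrow> (g has_derivative g' x) (at x within X)"
      "\<And>h. continuous_on X (\<lambda>x. g' x h)"
    using C1_withinE[OF g] by metis
  show ?thesis
    by (rule C1_withinI[of X _ "\<lambda>x h. f' x h + g' x h"])
      (auto intro!: has_derivative_add f' g' continuous_on_add)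
qed

lemma C1_within_linear_compose:
  assumes "bounded_linear l" "C1_within X f"
  shows "C1_within X (\<lambda>x. l (f x))"
  by (rule C1_within_compose[OF assms(2) C1_within_bounded_linear[OF assms(1), of UNIV]]) simp

lemma C1_within_diff:
  assumes "C1_within X f" "C1_within X g"
  shows "C1_within X (\<lambda>x. f x - g x)"
  using C1_within_add[OF assms(1) C1_within_linear_compose[OF bounded_linear_minus[OF bounded_linear_ident] assms(2)]]
  by simp

lemma C1_within_Pair:
  assumes "C1_within X f" "C1_within X g"
  shows "C1_within X (\<lambda>x. (f x, g x))"
  using C1_within_add[OF
      C1_within_linear_compose[OF bounded_linear_Pair[OF bounded_linear_ident bounded_linear_zero] assms(1)]
      C1_within_linear_compose[OF bounded_linear_Pair[OF bounded_linear_zero bounded_linear_ident] assms(2)]]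
  by simp

lemmas C1_within_mult = C1_within_bilinear[OF bounded_bilinear_mult]
lemmas C1_within_scaleR = C1_within_bilinear[OF bounded_bilinear_scaleR]
lemmas C1_within_fst = C1_within_bounded_linear[OF bounded_linear_fst]
lemmas C1_within_snd = C1_within_bounded_linear[OF bounded_linear_snd]
lemmas C1_within_fst_compose = C1_within_linear_compose[OF bounded_linear_fst]
lemmas C1_within_snd_compose = C1_within_linear_compose[OF bounded_linear_snd]
lemmas C1_within_ident = C1_within_bounded_linear[OF bounded_linear_ident]

lemma C1_within_real_derivative:
  fixes f :: "real \<Rightarrow> 'b::euclidean_space"
  assumes "\<And>x. x \<in> X \<Longrightarrow> (f has_vector_derivative f' x) (at x within X)" "continuous_on X f'"
  shows "C1_within X f"
  by (rule C1_withinI[of X f "\<lambda>x h. h *\<^sub>R f' x"])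
    (use assms in \<open>auto simp: has_vector_derivative_def intro!: continuous_intros\<close>)

lemma C1_within_exp: "C1_within X f \<Longrightarrow> C1_within X (\<lambda>x. exp (f x :: real))"
  by (rule C1_within_compose[of _ _ UNIV], assumption,
      rule C1_within_real_derivative[of UNIV _ exp])
    (auto simp flip: has_real_derivative_iff_has_vector_derivative intro!: continuous_intros DERIV_exp)

lemma C1_within_inverse:
  assumes "C1_within X f" "\<And>x. x \<in> X \<Longrightarrow> f x \<noteq> (0::real)"
  shows "C1_within X (\<lambda>x. inverse (f x))"
proof (rule C1_within_compose[OF assms(1)])
  show "C1_within (-{0::real}) inverse"
    by (rule C1_within_real_derivative[of _ _ "\<lambda>x. - (inverse x ^ 2)"])
      (auto simp flip: has_real_derivative_iff_has_vector_derivative simp: power2_eq_square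
        intro!: continuous_intros derivative_eq_intros)
qed (use assms(2) in auto)

lemma C1_within_norm:
  assumes "C1_within X f" "\<And>x. x \<in> X \<Longrightarrow> f x \<noteq> 0"
  shows "C1_within X (\<lambda>x. norm (f x))"
proof (rule C1_within_compose[OF assms(1)])
  show "C1_within (-{0::'b}) norm"
  proof (rule C1_withinI[of _ _ "\<lambda>x h. h \<bullet> sgn x"])
    show "(norm has_derivative (\<lambda>h. h \<bullet> sgn x)) (at x within - {0})" if "x \<in> - {0}" for x :: 'b
      using that by (simp add: has_derivative_at_withinI has_derivative_norm)
  qed (auto intro!: continuous_intros simp: sgn_div_norm)
qed (use assms(2) in auto)

lemma C1_within_sgn: "C1_within (-{0::'a::euclidean_space}) sgn"
  unfolding sgn_div_norm[abs_def]
  by (intro C1_within_scaleR C1_within_inverse C1_within_norm C1_within_ident) auto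

text \<open>At interior points the derivative is unique, so the local derivatives agree on overlaps
  and glue to one continuous field.\<close>

lemma C1_within_open_local:
  assumes "open X" "\<And>x. x \<in> X \<Longrightarrow> \<exists>N. open N \<and> x \<in> N \<and> C1_within N f"
  shows "C1_within X f"
proof -
  have "\<exists>f'. (f has_derivative blinfun_apply f') (at x)" if "x \<in> X" for x
    using assms(2)[OF that] unfolding C1_within_def by (metis at_within_open)
  then obtain f' where f': "\<And>x. x \<in> X \<Longrightarrow> (f has_derivative blinfun_apply (f' x)) (at x)"
    by metis
  have "continuous (at x) f'" if x: "x \<in> X" for x
  proof -
    obtain N F where N: "open N" "x \<in> N"
      and F: "\<forall>y\<in>N. (f has_derivative blinfun_apply (F y)) (at y within N)" "continuous_on N F"
      using assms(2)[OF x] unfolding C1_within_def by blast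
    have eq: "F y = f' y" if "y \<in> N \<inter> X" for y
      using F(1) f'[of y] that N(1) has_derivative_unique[of f "blinfun_apply (F y)" y "blinfun_apply (f' y)"]
      by (auto simp: at_within_open[OF _ N(1)] intro: blinfun_eqI)
    have "continuous_on (N \<inter> X) f'"
      using continuous_on_subset[OF F(2)] eq by (metis (no_types, lifting) Int_lower1 continuous_on_cong)
    then show ?thesis using N x assms(1) continuous_on_eq_continuous_at[OF open_Int[OF N(1) assms(1)]] by blast
  qed
  then show ?thesis unfolding C1_within_def
    by (intro exI[of _ f'] conjI ballI continuous_at_imp_continuous_on
        has_derivative_at_withinI[OF f'])
qed

lemma C1_within_integral:
  fixes F :: "'a::euclidean_space \<times> real \<Rightarrow> 'b::euclidean_space"
  assumes F: "C1_within (P \<times> {0..1}) F" and P: "convex P"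
  shows "C1_within P (\<lambda>p. integral {0..1} (\<lambda>s. F (p, s)))"
proof -
  obtain F' where F': "\<forall>z\<in>P \<times> {0..1}. (F has_derivative blinfun_apply (F' z)) (at z within P \<times> {0..1})"
    "continuous_on (P \<times> {0..1}) F'"
    using F unfolding C1_within_def by blast
  \<comment> \<open>The partial derivative in the parameter is the total derivative composed with
    the inclusion of the first factor.\<close>
  let ?i = "Blinfun (\<lambda>h::'a. (h, 0::real))"
  have i: "blinfun_apply ?i = (\<lambda>h. (h, 0))"
    by (rule bounded_linear_Blinfun_apply) (intro bounded_linear_Pair bounded_linear_ident bounded_linear_zero)
  have d: "((\<lambda>p. F (p, s)) has_derivative blinfun_apply (F' (p, s) o\<^sub>L ?i)) (at p within P)"
    if "p \<in> P" "s \<in> cbox 0 1" for p s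
  proof -
    have "((\<lambda>p. (p, s)) has_derivative (\<lambda>h. (h, 0))) (at p within P)"
      by (auto intro!: derivative_eq_intros)
    from has_derivative_in_compose2[OF _ _ that(1) this, of "P \<times> {0..1}" F "\<lambda>z. blinfun_apply (F' z)"]
    have "((\<lambda>p. F (p, s)) has_derivative (\<lambda>h. blinfun_apply (F' (p, s)) (h, 0))) (at p within P)"
      using F'(1) that by (simp add: image_subset_iff)
    then show ?thesis by (simp add: blinfun_compose.rep_eq comp_def i)
  qed
  have c: "continuous_on (P \<times> cbox 0 1) (\<lambda>(p, s). F' (p, s) o\<^sub>L ?i)"
    using F'(2) by (auto simp: case_prod_unfold intro!: bounded_bilinear.continuous_on[OF bounded_bilinear_blinfun_compose] continuous_intros)
  have int: "(\<lambda>s. F (p, s)) integrable_on cbox 0 1" if "p \<in> P" for p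
    by (rule integrable_continuous)
      (use that in \<open>auto intro!: continuous_on_compose2[OF C1_within_continuous_on[OF F]] continuous_intros\<close>)
  show ?thesis
    unfolding C1_within_def
    using leibniz_rule[OF d int c _ P] integral_continuous_on_param[OF c]
    by (intro exI[of _ "\<lambda>p. integral (cbox 0 1) (\<lambda>s. F' (p, s) o\<^sub>L ?i)"]) auto
qed

section \<open>Gradients on the sphere\<close>

lemma C1_on_openI:
  assumes "C1_within X f" "open X" "S \<subseteq> X"
  shows "C1_on S f"
proof -
  obtain f' where f': "\<forall>x\<in>X. (f has_derivative blinfun_apply (f' x)) (at x within X)" "continuous_on X f'"
    using assms(1) unfolding C1_within_def by blast
  have "\<forall>x\<in>X. (f has_derivative blinfun_apply (f' x)) (at x)"
    using f'(1) assms(2) by (simp add: at_within_open[OF _ assms(2)])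
  then have "open X \<and> x \<in> X \<and> (\<forall>x\<in>X. (f has_derivative blinfun_apply (f' x)) (at x)) \<and>
      continuous_on X f' \<and> (\<forall>y\<in>X \<inter> S. f y = f y)" if "x \<in> S" for x
    using f'(2) assms(2,3) that by (simp add: subset_iff)
  then show ?thesis
    unfolding C1_on_def by (metis (no_types))
qed

text \<open>The local extensions supplied by \<open>C1_on\<close> may disagree off the sphere.
  Composing with \<open>sgn\<close> uses only their values on the sphere, so they merge into a
  single C1 function, constant along rays.\<close>

lemma C1_on_sphere_sgn:
  fixes h :: "'a::euclidean_space \<Rightarrow> 'b::euclidean_space"
  assumes "C1_on (sphere 0 1) h"
  shows "C1_within (-{0}) (\<lambda>x. h (sgn x))"
proof (rule C1_within_open_local)
  fix x :: 'a assume x: "x \<in> -{0}"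
  have on_sphere: "sgn y \<in> sphere 0 1" if "y \<noteq> 0" for y :: 'a using that by (simp add: norm_sgn)
  then obtain U F F' where U: "open U" "sgn x \<in> U"
    and F: "\<forall>y\<in>U. (F has_derivative blinfun_apply (F' y)) (at y)" "continuous_on U F'"
    and eq: "\<forall>y\<in>U \<inter> sphere 0 1. F y = h y"
    using bspec[OF assms[unfolded C1_on_def] on_sphere[of x]] x by auto
  let ?N = "sgn -` U \<inter> (-{0})"
  have "open ?N"
    using continuous_open_preimage[of "-{0::'a}" sgn U] C1_within_continuous_on[OF C1_within_sgn] U(1)
    by (simp add: Int_commute open_Compl)
  moreover have "C1_within U F"
    unfolding C1_within_def using F by (intro exI[of _ F']) (simp add: at_within_open[OF _ U(1)])
  then have "C1_within ?N (\<lambda>y. F (sgn y))"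
    using C1_within_compose[OF C1_within_subset[OF C1_within_sgn, of ?N]] by blast
  then have "C1_within ?N (\<lambda>y. h (sgn y))"
    by (rule C1_within_cong) (use eq on_sphere in auto)
  ultimately show "\<exists>N. open N \<and> x \<in> N \<and> C1_within N (\<lambda>x. h (sgn x))"
    using U(2) x by (intro exI[of _ ?N]) auto
qed (simp add: open_Compl)

lemma has_derivative_sgn_unit:
  fixes \<eta> :: "'a::real_inner"
  assumes "norm \<eta> = 1"
  shows "(sgn has_derivative (\<lambda>x. x - (\<eta> \<bullet> x) *\<^sub>R \<eta>)) (at \<eta>)"
proof -
  have "\<eta> \<noteq> 0" using assms by auto
  then have "(norm has_derivative (\<lambda>h. h \<bullet> \<eta>)) (at \<eta>)"
    using has_derivative_norm[of \<eta>] assms by (simp add: sgn_div_norm)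
  with \<open>\<eta> \<noteq> 0\<close> have "((\<lambda>x. inverse (norm x) *\<^sub>R x) has_derivative (\<lambda>x. x - (\<eta> \<bullet> x) *\<^sub>R \<eta>)) (at \<eta>)"
    using assms by (auto intro!: derivative_eq_intros simp: sgn_div_norm inner_commute algebra_simps)
  then show ?thesis by (simp add: sgn_div_norm[abs_def])
qed

text \<open>Turns a derivative along the sphere into one at an interior point, where uniqueness and
  the first-order condition at an extremum apply. The derivative of \<open>sgn\<close> projects onto
  the tangent plane, which a tangent \<open>g\<close> does not notice.\<close>

lemma has_sphere_gradient_sgn:
  assumes "has_sphere_gradient h g \<eta>" "\<eta> \<in> sphere 0 1"
  shows "((\<lambda>x. h (sgn x)) has_derivative (\<lambda>x. g \<bullet> x)) (at \<eta>)"
proof -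
  have n: "norm \<eta> = 1" and g: "g \<bullet> \<eta> = 0" "(h has_derivative (\<lambda>x. g \<bullet> x)) (at \<eta> within sphere 0 1)"
    using assms by (auto simp: has_sphere_gradient_def)
  have "\<eta> \<noteq> 0" using n by auto
  have s: "(sgn has_derivative (\<lambda>x. x - (\<eta> \<bullet> x) *\<^sub>R \<eta>)) (at \<eta> within -{0})"
    by (rule has_derivative_at_withinI[OF has_derivative_sgn_unit[OF n]])
  have "sgn \<eta> = \<eta>" using n by (simp add: sgn_div_norm)
  moreover have "sgn ` (-{0}) \<subseteq> sphere (0::real^3) 1" by (auto simp: norm_sgn split: if_splits)
  ultimately have "(h has_derivative (\<lambda>x. g \<bullet> x)) (at (sgn \<eta>) within sgn ` (-{0}))"
    using has_derivative_subset[OF g(2)] by metis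
  from has_derivative_in_compose[OF s this]
  have "((\<lambda>x. h (sgn x)) has_derivative (\<lambda>x. g \<bullet> x)) (at \<eta> within -{0})"
    using g(1) by (simp add: inner_diff_right)
  moreover have "at \<eta> within -{0} = at \<eta>"
    by (rule at_within_open) (use \<open>\<eta> \<noteq> 0\<close> in \<open>auto simp: open_Compl\<close>)
  ultimately show ?thesis by metis
qed

lemma sphere_gradient_eq:
  assumes "has_sphere_gradient h g \<eta>" "\<eta> \<in> sphere 0 1"
  shows "sphere_gradient h \<eta> = g"
  unfolding sphere_gradient_def
proof (rule the_equality)
  show "has_sphere_gradient h g \<eta>" by fact
next
  fix g' assume "has_sphere_gradient h g' \<eta>"
  from has_derivative_unique[OF has_sphere_gradient_sgn[OF this assms(2)] has_sphere_gradient_sgn[OF assms]]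
  have "g' \<bullet> x = g \<bullet> x" for x by metis
  then show "g' = g" by (metis inner_commute vector_eq_ldot)
qed

text \<open>Differentiating the constant function c -> h (c \<open>\<eta>\<close>) at c = 1 shows
  that the ambient gradient is already tangent to the sphere.\<close>

lemma has_sphere_gradient_homogeneous:
  assumes h: "(h has_derivative h') (at \<eta>)" and hom: "\<And>c. c > 0 \<Longrightarrow> h (c *\<^sub>R \<eta>) = h \<eta>"
  shows "has_sphere_gradient h (\<Sum>b\<in>Basis. h' b *\<^sub>R b) \<eta>"
    and "\<And>x. (\<Sum>b\<in>Basis. h' b *\<^sub>R b) \<bullet> x = h' x"
proof -
  have lin: "linear h'" using h by (simp add: has_derivative_bounded_linear bounded_linear.linear)
  show *: "(\<Sum>b\<in>Basis. h' b *\<^sub>R b) \<bullet> x = h' x" for x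
  proof -
    have "h' x = h' (\<Sum>b\<in>Basis. (x \<bullet> b) *\<^sub>R b)" by (simp add: euclidean_representation)
    also have "\<dots> = (\<Sum>b\<in>Basis. (x \<bullet> b) *\<^sub>R h' b)" by (simp add: linear_sum[OF lin] linear_scale[OF lin])
    finally show ?thesis by (simp add: inner_sum_left inner_commute[of x] mult.commute)
  qed
  have "((\<lambda>c. h (c *\<^sub>R \<eta>)) has_derivative (\<lambda>c. h' (c *\<^sub>R \<eta>))) (at 1)"
    by (rule has_derivative_compose[where f = "\<lambda>c. c *\<^sub>R \<eta>" and g = h])
      (use h in \<open>auto intro!: derivative_eq_intros\<close>)
  moreover have "((\<lambda>c. h (c *\<^sub>R \<eta>)) has_derivative (\<lambda>c. 0)) (at (1::real))"
    by (rule has_derivative_transform_within_open[of "\<lambda>_. h \<eta>" _ _ _ "{0<..}"])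
      (auto simp: hom)
  ultimately have "h' (1 *\<^sub>R \<eta>) = 0" using has_derivative_unique by metis
  then show "has_sphere_gradient h (\<Sum>b\<in>Basis. h' b *\<^sub>R b) \<eta>"
    unfolding has_sphere_gradient_def * using has_derivative_at_withinI[OF h] by simp
qed

lemma sphere_nonzero: "\<eta> \<in> sphere (0::real^3) 1 \<Longrightarrow> \<eta> \<noteq> 0" by auto

lemma sphere_norm_inf_bound:
  assumes "continuous_on (sphere 0 1) h" "\<eta> \<in> sphere 0 1"
  shows "\<bar>h \<eta>\<bar> \<le> sphere_norm_inf h"
  unfolding sphere_norm_inf_def
  by (intro cSUP_upper assms bounded_imp_bdd_above compact_imp_bounded compact_continuous_image
      continuous_on_rabs) auto

lemma sphere_norm_inf_le:
  assumes "\<And>\<eta>. \<eta> \<in> sphere 0 1 \<Longrightarrow> \<bar>h \<eta>\<bar> \<le> B"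
  shows "sphere_norm_inf h \<le> B"
  unfolding sphere_norm_inf_def by (rule cSUP_least) (use assms in \<open>auto\<close>)

subsection \<open>Quaternions\<close>

lemma bounded_bilinear_qmult: "bounded_bilinear qmult"
  unfolding bilinear_conv_bounded_bilinear[symmetric] bilinear_def
  by (auto intro!: linearI simp: qmult_def cross3_simps)

lemma bounded_linear_qconj: "bounded_linear qconj"
  unfolding qconj_def[abs_def] by (intro bounded_linear_Pair bounded_linear_fst bounded_linear_minus bounded_linear_snd)

lemma bounded_linear_qim: "bounded_linear qim"
  unfolding qim_def[abs_def] by (intro bounded_linear_Pair bounded_linear_zero bounded_linear_ident)

lemma qmult_assoc: "qmult (qmult p q) r = qmult p (qmult q r)"
  by (simp add: qmult_def cross3_simps forall_3)

lemma qconj_qmult: "qconj (qmult p q) = qmult (qconj q) (qconj p)"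
  by (simp add: qmult_def qconj_def cross3_simps)

lemma qconj_qconj [simp]: "qconj (qconj q) = q"
  by (simp add: qconj_def)

lemma norm_qconj [simp]: "norm (qconj q) = norm q"
  by (simp add: qconj_def norm_Pair norm_prod_def)

lemma qmult_qconj: "qmult q (qconj q) = ((norm q)\<^sup>2, 0)"
  by (simp add: qmult_def qconj_def norm_prod_def power2_norm_eq_inner power2_eq_square[of "fst q"])

lemma qmult_real: "qmult (a, 0) q = a *\<^sub>R q" "qmult q (a, 0) = a *\<^sub>R q"
  by (simp_all add: qmult_def prod_eq_iff)

lemma norm_qmult: "norm (qmult p q) = norm p * norm q"
proof -
  have "((norm (qmult p q))\<^sup>2, 0) = qmult p (qmult (qmult q (qconj q)) (qconj p))"
    by (simp only: qmult_qconj[symmetric] qconj_qmult qmult_assoc)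
  also have "\<dots> = (norm q)\<^sup>2 *\<^sub>R ((norm p)\<^sup>2, 0)"
    by (simp only: qmult_qconj qmult_real bounded_bilinear.scaleR_right[OF bounded_bilinear_qmult])
  finally have "(norm (qmult p q))\<^sup>2 = (norm p * norm q)\<^sup>2"
    by (simp add: power_mult_distrib mult.commute)
  then show ?thesis by (rule power2_eq_imp_eq) simp_all
qed

text \<open>The real part of q u q* vanishes, so \<open>snd\<close> loses nothing and rotations can
  be handled by associativity alone.\<close>

lemma qim_qrot: "qim (qrot q u) = qmult (qmult q (qim u)) (qconj q)"
  by (simp add: qrot_def qim_def qmult_def qconj_def cross3_simps)

lemma norm_qrot: "norm q = 1 \<Longrightarrow> norm (qrot q u) = norm u"
proof -
  have "norm (qim w) = norm w" for w by (simp add: qim_def)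
  then show "norm q = 1 \<Longrightarrow> ?thesis" by (metis norm_qmult norm_qconj qim_qrot mult_1 mult_1_right)
qed

lemma qrot_qconj_qrot:
  assumes "norm q = 1" shows "qrot (qconj q) (qrot q u) = u"
proof -
  have "qim (qrot (qconj q) (qrot q u)) = qmult (qmult (qconj q) q) (qmult (qim u) (qmult (qconj q) q))"
    by (simp add: qim_qrot qmult_assoc)
  also have "qmult (qconj q) q = (1, 0)" using qmult_qconj[of "qconj q"] assms by simp
  finally show ?thesis by (simp add: qmult_real) (simp add: qim_def)
qed

lemma qrot_qrot_qconj: "norm q = 1 \<Longrightarrow> qrot q (qrot (qconj q) u) = u"
  using qrot_qconj_qrot[of "qconj q"] by simp

lemma bounded_linear_qrot: "bounded_linear (qrot q)"
  unfolding qrot_def[abs_def]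
  by (intro bounded_linear_compose[OF bounded_linear_snd]
      bounded_linear_compose[OF bounded_bilinear.bounded_linear_left[OF bounded_bilinear_qmult]]
      bounded_linear_compose[OF bounded_bilinear.bounded_linear_right[OF bounded_bilinear_qmult]]
      bounded_linear_qim)

lemma qrot_scaleR: "qrot p (c *\<^sub>R u) = c *\<^sub>R qrot p u"
  by (rule linear_scale[OF bounded_linear.linear[OF bounded_linear_qrot]])

lemma C1_within_qrot:
  assumes "C1_within X p" "C1_within X u"
  shows "C1_within X (\<lambda>x. qrot (p x) (u x))"
  unfolding qrot_def
  by (intro C1_within_snd_compose C1_within_bilinear[OF bounded_bilinear_qmult] assms
      C1_within_linear_compose[OF bounded_linear_qim] C1_within_linear_compose[OF bounded_linear_qconj])

text \<open>With a = q* z q and w* = -w, the two terms that differentiate q add up to half the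
  commutator of a and w, which is their cross product. For z = M - C this is the image motion of a
  fixed scene point.\<close>

lemma qrot_qconj_has_vector_derivative:
  assumes q: "(q has_vector_derivative (1/2) *\<^sub>R qmult (q t) (qim w)) (at t within X)"
    and z: "(z has_vector_derivative z') (at t within X)"
  shows "((\<lambda>s. qrot (qconj (q s)) (z s)) has_vector_derivative
           cross3 (qrot (qconj (q t)) (z t)) w + qrot (qconj (q t)) z') (at t within X)"
proof -
  note B = bounded_bilinear.has_vector_derivative[OF bounded_bilinear_qmult]
  note L = bounded_linear.has_vector_derivative
  have "((\<lambda>s. snd (qmult (qmult (qconj (q s)) (qim (z s))) (q s))) has_vector_derivative
     snd (qmult (qmult (qconj (q t)) (qim (z t))) ((1/2) *\<^sub>R qmult (q t) (qim w)) +
      qmult (qmult (qconj (q t)) (qim z') + qmult (qconj ((1/2) *\<^sub>R qmult (q t) (qim w))) (qim (z t))) (q t)))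
     (at t within X)"
    by (intro L[OF bounded_linear_snd] B L[OF bounded_linear_qim] L[OF bounded_linear_qconj] q z)
  moreover have "qmult (qmult (qconj (q t)) (qim (z t))) ((1/2) *\<^sub>R qmult (q t) (qim w)) =
      (1/2) *\<^sub>R qmult (qim (qrot (qconj (q t)) (z t))) (qim w)"
    by (simp add: qim_qrot qmult_assoc bounded_bilinear.scaleR_right[OF bounded_bilinear_qmult])
  moreover have "qconj (qim w) = - qim w" by (simp add: qconj_def qim_def)
  then have "qmult (qmult (qconj ((1/2) *\<^sub>R qmult (q t) (qim w))) (qim (z t))) (q t) =
      - ((1/2) *\<^sub>R qmult (qim w) (qim (qrot (qconj (q t)) (z t))))"
    by (simp add: qim_qrot qmult_assoc qconj_qmult bounded_bilinear.scaleR_right[OF bounded_bilinear_qmult]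
      bounded_bilinear.scaleR_left[OF bounded_bilinear_qmult] bounded_bilinear.minus_left[OF bounded_bilinear_qmult]
      linear_scale[OF bounded_linear.linear[OF bounded_linear_qconj]])
  moreover have "snd ((1/2) *\<^sub>R qmult (qim a) (qim w) - (1/2) *\<^sub>R qmult (qim w) (qim a)) = cross3 a w" for a
    using cross_skew[of w a] by (simp add: qmult_def qim_def flip: scaleR_left_distrib)
  ultimately show ?thesis
    by (simp add: qrot_def bounded_bilinear.add_left[OF bounded_bilinear_qmult] algebra_simps)
qed

section \<open>The exit point of a ray from a convex domain\<close>

text \<open>The direction need not be a unit vector. The value scales inversely with
  \<open>\<xi>\<close>, so the exit point depends only on the ray.\<close>

definition radial :: "'a::euclidean_space set \<Rightarrow> 'a \<Rightarrow> 'a \<Rightarrow> real" where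
  "radial \<Omega> c \<xi> = (THE r. 0 < r \<and> c + r *\<^sub>R \<xi> \<in> frontier \<Omega>)"

locale convex_domain =
  fixes \<Omega> :: "'a::euclidean_space set"
  assumes open_domain: "open \<Omega>" and convex_domain: "convex \<Omega>" and bounded_domain: "bounded \<Omega>"
begin

text \<open>A segment from an interior point of a convex set to a point of its closure stays
  interior until its end. Both the uniqueness of the exit point and its continuity rest on
  this.\<close>

lemma inside_before_closure_point:
  assumes "c \<in> \<Omega>" "\<xi> \<noteq> 0" "0 \<le> r" "r < s" "c + s *\<^sub>R \<xi> \<in> closure \<Omega>"
  shows "c + r *\<^sub>R \<xi> \<in> \<Omega>"
proof (cases "r = 0")
  case False
  have "c + r *\<^sub>R \<xi> \<in> open_segment c (c + s *\<^sub>R \<xi>)"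
    unfolding in_segment using assms False
    by (auto intro!: exI[of _ "r / s"] simp: algebra_simps)
  then show ?thesis
    using in_interior_closure_convex_segment[OF convex_domain _ assms(5), of c] assms(1)
    by (auto simp: interior_open[OF open_domain])
qed (use assms in simp)

lemma frontier_disjoint: "p \<in> frontier \<Omega> \<Longrightarrow> p \<notin> \<Omega>"
  using open_domain by (simp add: frontier_def interior_open)

lemma frontier_closure: "p \<in> frontier \<Omega> \<Longrightarrow> p \<in> closure \<Omega>"
  by (simp add: frontier_def)

lemma radial_eqI:
  assumes "c \<in> \<Omega>" "0 < r" "c + r *\<^sub>R \<xi> \<in> frontier \<Omega>"
  shows "radial \<Omega> c \<xi> = r"
  unfolding radial_def
proof (rule the_equality)
  have nz: "\<xi> \<noteq> 0" using frontier_disjoint[OF assms(3)] assms(1) by auto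
  show "0 < r \<and> c + r *\<^sub>R \<xi> \<in> frontier \<Omega>" using assms by simp
  fix s assume s: "0 < s \<and> c + s *\<^sub>R \<xi> \<in> frontier \<Omega>"
  have "\<not> r < s"
    using inside_before_closure_point[OF assms(1) nz, of r s] frontier_disjoint[OF assms(3)]
      frontier_closure s assms(2) by auto
  moreover have "\<not> s < r"
    using inside_before_closure_point[OF assms(1) nz, of s r] frontier_disjoint
      frontier_closure[OF assms(3)] s assms(2) by auto
  ultimately show "s = r" by simp
qed

lemma radial_hits:
  assumes "c \<in> \<Omega>" "\<xi> \<noteq> 0"
  shows "0 < radial \<Omega> c \<xi>" "c + radial \<Omega> c \<xi> *\<^sub>R \<xi> \<in> frontier \<Omega>"
proof -
  have "c \<in> interior \<Omega>" using assms(1) by (simp add: interior_open[OF open_domain])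
  then obtain d where d: "0 < d" "c + d *\<^sub>R \<xi> \<in> frontier \<Omega>"
    using ray_to_frontier[OF bounded_domain _ assms(2)] by metis
  then show "0 < radial \<Omega> c \<xi>" "c + radial \<Omega> c \<xi> *\<^sub>R \<xi> \<in> frontier \<Omega>"
    using radial_eqI[OF assms(1) d] by simp_all
qed

text \<open>A point slightly before the exit lies in the open domain, and one slightly beyond lies
  outside its closure. Both conditions are open, hence persist for nearby rays and enclose their
  exit parameter.\<close>

lemma radial_continuous_on: "continuous_on (\<Omega> \<times> -{0}) (\<lambda>z. radial \<Omega> (fst z) (snd z))"
proof -
  have op: "open (\<Omega> \<times> (-{0::'a}))" by (simp add: open_domain open_Times open_Compl)
  have "((\<lambda>z. radial \<Omega> (fst z) (snd z)) \<longlongrightarrow> radial \<Omega> c \<xi>) (at (c, \<xi>))"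
    if c: "c \<in> \<Omega>" "\<xi> \<noteq> 0" for c \<xi>
  proof -
    have ev: "\<forall>\<^sub>F z in at (c, \<xi>). z \<in> \<Omega> \<times> -{0}"
      using op c by (simp add: eventually_at_in_open')
    have lim: "((\<lambda>z. fst z + r *\<^sub>R snd z) \<longlongrightarrow> c + r *\<^sub>R \<xi>) (at (c, \<xi>))" for r
      by (auto intro!: tendsto_eq_intros)
    let ?r = "radial \<Omega> c \<xi>"
    note R = radial_hits[OF c]
    show ?thesis
    proof (rule order_tendstoI)
      fix a assume a: "a < ?r"
      \<comment> \<open>The bound \<open>a\<close> may be negative, whereas the segment argument
        needs a nonnegative parameter.\<close>
      let ?a = "max a 0"
      have "c + ?a *\<^sub>R \<xi> \<in> \<Omega>"
        by (rule inside_before_closure_point[OF c _ _ frontier_closure[OF R(2)]]) (use a R in auto)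
      then have "\<forall>\<^sub>F z in at (c, \<xi>). fst z + ?a *\<^sub>R snd z \<in> \<Omega>"
        by (rule topological_tendstoD[OF lim open_domain])
      with ev show "\<forall>\<^sub>F z in at (c, \<xi>). a < radial \<Omega> (fst z) (snd z)"
      proof eventually_elim
        case (elim z)
        then have z: "fst z \<in> \<Omega>" "snd z \<noteq> 0" by auto
        note Rz = radial_hits[OF z]
        have "radial \<Omega> (fst z) (snd z) \<noteq> ?a" using Rz frontier_disjoint elim(2) by auto
        moreover have "\<not> radial \<Omega> (fst z) (snd z) < ?a"
          using inside_before_closure_point[OF z, of "radial \<Omega> (fst z) (snd z)" ?a] Rz
            frontier_disjoint closure_subset elim(2) by (metis less_imp_le subsetD)
        ultimately show ?case by simp
      qed
    next
      fix a assume a: "a > ?r"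
      have "c + a *\<^sub>R \<xi> \<in> - closure \<Omega>"
        using inside_before_closure_point[OF c _ a] R frontier_disjoint by auto
      then have "\<forall>\<^sub>F z in at (c, \<xi>). fst z + a *\<^sub>R snd z \<in> - closure \<Omega>"
        by (rule topological_tendstoD[OF lim, rotated]) (simp add: open_Compl)
      with ev show "\<forall>\<^sub>F z in at (c, \<xi>). radial \<Omega> (fst z) (snd z) < a"
      proof eventually_elim
        case (elim z)
        then have z: "fst z \<in> \<Omega>" "snd z \<noteq> 0" by auto
        note Rz = radial_hits[OF z]
        have "0 < a" using a R by simp
        have "radial \<Omega> (fst z) (snd z) \<noteq> a" using Rz frontier_closure elim(2) by auto
        moreover have "\<not> a < radial \<Omega> (fst z) (snd z)"
          using inside_before_closure_point[OF z _ _ frontier_closure[OF Rz(2)], of a] elim(2)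
            \<open>0 < a\<close> closure_subset[of \<Omega>] by auto
        ultimately show ?case by simp
      qed
    qed
  qed
  then show ?thesis
    by (auto simp: continuous_on_eq_continuous_at[OF op] isCont_def)
qed

lemma frontier_point_via_radial:
  assumes "c \<in> \<Omega>" "p \<in> frontier \<Omega>" "a > 0" "\<xi> = a *\<^sub>R (p - c)"
  shows "c + radial \<Omega> c \<xi> *\<^sub>R \<xi> = p"
proof -
  have "radial \<Omega> c \<xi> = inverse a"
    by (rule radial_eqI) (use assms in auto)
  then show ?thesis using assms by simp
qed

text \<open>Implicit differentiation of \<open>nu p \<bullet> (c + r *\<^sub>R \<xi> - p) = o(norm (c + r *\<^sub>R \<xi> - p))\<close>, with \<open>p\<close> the
  exit point of the ray; strict support gives \<open>nu p \<bullet> \<xi> > 0\<close>, so the equation can be solved for the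
  variation of \<open>r\<close>.\<close>

lemma radial_C1_within:
  assumes sup: "\<And>p x. p \<in> frontier \<Omega> \<Longrightarrow> x \<in> \<Omega> \<Longrightarrow> nu p \<bullet> x < nu p \<bullet> p"
    and cont: "continuous_on (frontier \<Omega>) nu"
    and tangent: "\<And>p. p \<in> frontier \<Omega> \<Longrightarrow> ((\<lambda>M. nu p \<bullet> M) has_derivative (\<lambda>_. 0)) (at p within frontier \<Omega>)"
  shows "C1_within (\<Omega> \<times> -{0}) (\<lambda>z. radial \<Omega> (fst z) (snd z))"
proof -
  define X where "X = \<Omega> \<times> (-{0::'a})"
  define \<rho> where "\<rho> z = radial \<Omega> (fst z) (snd z)" for z
  define G where "G z = fst z + \<rho> z *\<^sub>R snd z" for z
  have \<rho>cont: "continuous_on X \<rho>" using radial_continuous_on by (simp add: X_def \<rho>_def[abs_def])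
  then have Gcont: "continuous_on X G" unfolding G_def[abs_def] by (intro continuous_intros)
  have Gf: "G z \<in> frontier \<Omega>" and \<rho>pos: "\<rho> z > 0" if "z \<in> X" for z
    using radial_hits[of "fst z" "snd z"] that by (simp_all add: X_def \<rho>_def G_def mem_Times_iff)
  have npos: "nu (G z) \<bullet> snd z > 0" if "z \<in> X" for z
  proof -
    have "0 < \<rho> z * (nu (G z) \<bullet> snd z)"
      using sup[OF Gf[OF that], of "fst z"] that by (auto simp: X_def G_def inner_add_right)
    then show ?thesis using \<rho>pos[OF that] by (simp add: zero_less_mult_iff)
  qed
  define \<rho>' where "\<rho>' z h = - (nu (G z) \<bullet> (fst h + \<rho> z *\<^sub>R snd h)) / (nu (G z) \<bullet> snd z)" for z h
  have nucont: "continuous_on X (\<lambda>z. nu (G z))"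
    by (rule continuous_on_compose2[OF cont Gcont]) (use Gf in blast)
  have "(\<rho> has_derivative \<rho>' z) (at z within X)" if z: "z \<in> X" for z
    unfolding has_derivative_within_alt
  proof (intro conjI allI impI)
    show "bounded_linear (\<rho>' z)"
      unfolding \<rho>'_def[abs_def]
      by (intro bounded_linear_compose[OF bounded_linear_divide] bounded_linear_minus
          bounded_linear_compose[OF bounded_linear_inner_right] bounded_linear_add
          bounded_linear_fst bounded_linear_compose[OF bounded_linear_scaleR_right] bounded_linear_snd)
    fix e :: real assume e: "e > 0"
    define n where "n = nu (G z)"
    define a where "a = n \<bullet> snd z"
    have a: "a > 0" using npos[OF z] by (simp add: a_def n_def)
    define B where "B = norm (snd z) + 1"
    define A where "A = norm n * (1 + \<rho> z) / a"
    have B: "B > 0" by (simp add: B_def add_nonneg_pos)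
    have A: "A \<ge> 0" using a \<rho>pos[OF z] by (simp add: A_def)
    define K where "K = norm n + 1 + \<rho> z + B * A"
    have K: "K > 0" using B A \<rho>pos[OF z] by (simp add: K_def add_nonneg_pos add_pos_nonneg)
    \<comment> \<open>Here \<open>A\<close> bounds the candidate increment \<open>L\<close> by
      \<open>A * N\<close>, \<open>B\<close> bounds \<open>norm (snd y)\<close> as soon as
      \<open>N < 1\<close>, and \<open>K\<close> collects the coefficients of \<open>N\<close>. The
      first entry of the minimum lets the error term on the right be absorbed by half of the left
      side; the second leaves exactly \<open>e * N\<close>.\<close>
    define \<epsilon> where "\<epsilon> = min (a / (2 * B)) (e * a / (2 * K))"
    have \<epsilon>: "\<epsilon> > 0" "\<epsilon> * B \<le> a / 2" "\<epsilon> * K \<le> e * a / 2"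
      using a e B K by (auto simp: \<epsilon>_def min_def field_simps)
    obtain d1 where d1: "d1 > 0"
      "\<And>M. M \<in> frontier \<Omega> \<Longrightarrow> norm (M - G z) < d1 \<Longrightarrow> \<bar>n \<bullet> M - n \<bullet> G z\<bar> \<le> \<epsilon> * norm (M - G z)"
      using tangent[OF Gf[OF z]] \<epsilon>(1) unfolding has_derivative_within_alt n_def by fastforce
    obtain d2 where d2: "d2 > 0" "\<And>y. y \<in> X \<Longrightarrow> norm (y - z) < d2 \<Longrightarrow> norm (G y - G z) < d1"
      using Gcont z d1(1) unfolding continuous_on_iff dist_norm by metis
    obtain d3 where d3: "d3 > 0" "\<And>y. y \<in> X \<Longrightarrow> norm (y - z) < d3 \<Longrightarrow> \<bar>\<rho> y - \<rho> z\<bar> < \<epsilon>"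
      using \<rho>cont z \<epsilon>(1) unfolding continuous_on_iff dist_norm real_norm_def by metis
    show "\<exists>d>0. \<forall>y\<in>X. norm (y - z) < d \<longrightarrow> norm (\<rho> y - \<rho> z - \<rho>' z (y - z)) \<le> e * norm (y - z)"
    proof (intro exI[of _ "min 1 (min d2 d3)"] conjI ballI impI)
      show "0 < min 1 (min d2 d3)" using d2 d3 by simp
      fix y assume y: "y \<in> X" "norm (y - z) < min 1 (min d2 d3)"
      define N where "N = norm (y - z)"
      define dr where "dr = \<rho> y - \<rho> z"
      define dc where "dc = fst (y - z)"
      define dx where "dx = snd (y - z)"
      define L where "L = \<rho>' z (y - z)"
      have N: "norm dc \<le> N" "norm dx \<le> N" "N < 1"
        using y norm_fst_le[of "fst (y - z)" "snd (y - z)"] norm_snd_le[of "snd (y - z)" "fst (y - z)"]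
        unfolding N_def dc_def dx_def by (simp_all only: prod.collapse)
      have y': "fst y = fst z + dc" "snd y = snd z + dx" by (simp_all add: dc_def dx_def)
      have L: "a * L = - (n \<bullet> dc) - \<rho> z * (n \<bullet> dx)"
        using a by (simp add: L_def \<rho>'_def n_def[symmetric] a_def[symmetric] dc_def dx_def inner_add_right)
      have dG: "G y - G z = dc + \<rho> z *\<^sub>R dx + dr *\<^sub>R snd y"
        by (simp add: G_def dr_def y' algebra_simps)
      have dr: "\<bar>dr\<bar> \<le> \<epsilon>" using d3(2)[of y] y by (simp add: dr_def)
      have "norm (snd y) \<le> B" using N norm_triangle_ineq[of "snd z" dx] by (simp add: y' B_def)
      have Gn: "norm (G y - G z) \<le> N + \<rho> z * N + \<bar>dr\<bar> * B"
      proof -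
        have "norm (G y - G z) \<le> norm dc + norm (\<rho> z *\<^sub>R dx) + norm (dr *\<^sub>R snd y)"
          unfolding dG by (intro norm_triangle_le add_mono norm_triangle_ineq) simp
        also have "\<dots> \<le> N + \<rho> z * N + \<bar>dr\<bar> * B"
          using N \<rho>pos[OF z] \<open>norm (snd y) \<le> B\<close> by (auto intro!: add_mono mult_left_mono)
        finally show ?thesis .
      qed
      have "\<bar>L\<bar> \<le> A * N"
      proof -
        have "a * \<bar>L\<bar> = \<bar>- (n \<bullet> dc) - \<rho> z * (n \<bullet> dx)\<bar>" using L a by (simp add: abs_mult flip: L)
        also have "\<dots> \<le> \<bar>n \<bullet> dc\<bar> + \<rho> z * \<bar>n \<bullet> dx\<bar>" using \<rho>pos[OF z] abs_mult[of "\<rho> z" "n \<bullet> dx"] by linarith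
        also have "\<dots> \<le> norm n * N + \<rho> z * (norm n * N)"
          using N \<rho>pos[OF z] Cauchy_Schwarz_ineq2[of n]
          by (intro add_mono mult_left_mono) (meson order_trans mult_left_mono norm_ge_zero | simp)+
        finally show ?thesis using a by (simp add: A_def field_simps)
      qed
      \<comment> \<open>Both terms on the right are small: the first by tangency at the exit point,
        the second as a product of two increments.\<close>
      have main: "a * (dr - L) = n \<bullet> (G y - G z) - dr * (n \<bullet> dx)"
        using L by (simp add: dG y' a_def inner_add_right algebra_simps)
      have "a * \<bar>dr - L\<bar> \<le> \<bar>n \<bullet> (G y - G z)\<bar> + \<bar>dr\<bar> * \<bar>n \<bullet> dx\<bar>"
        using a abs_triangle_ineq4[of "n \<bullet> (G y - G z)" "dr * (n \<bullet> dx)"] main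
        by (metis abs_mult abs_of_pos)
      also have "\<bar>n \<bullet> (G y - G z)\<bar> \<le> \<epsilon> * norm (G y - G z)"
        using d1(2)[OF Gf[OF y(1)] d2(2)[OF y(1)]] y by (simp add: inner_diff_right)
      also have "\<dots> \<le> \<epsilon> * (N + \<rho> z * N + \<bar>dr\<bar> * B)" using Gn \<epsilon> by simp
      also have "\<bar>dr\<bar> * \<bar>n \<bullet> dx\<bar> \<le> \<epsilon> * (norm n * N)"
      proof (intro mult_mono dr)
        have "\<bar>n \<bullet> dx\<bar> \<le> norm n * norm dx" by (rule Cauchy_Schwarz_ineq2)
        also have "\<dots> \<le> norm n * N" using N by (simp add: mult_left_mono)
        finally show "\<bar>n \<bullet> dx\<bar> \<le> norm n * N" .
      qed (use \<epsilon> in auto)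
      finally have 1: "a * \<bar>dr - L\<bar> \<le> \<epsilon> * (N + \<rho> z * N + \<bar>dr\<bar> * B) + \<epsilon> * (norm n * N)" by simp
      \<comment> \<open>The bound still contains \<open>dr\<close> itself; expressing it through the
        unknown error \<open>dr - L\<close> makes the absorption possible.\<close>
      have "\<bar>dr\<bar> \<le> \<bar>dr - L\<bar> + A * N" using \<open>\<bar>L\<bar> \<le> A * N\<close> by linarith
      then have "\<epsilon> * (\<bar>dr\<bar> * B) \<le> \<epsilon> * ((\<bar>dr - L\<bar> + A * N) * B)"
        using \<epsilon>(1) B by (intro mult_left_mono mult_right_mono) auto
      with 1 have "a * \<bar>dr - L\<bar> \<le> \<epsilon> * B * \<bar>dr - L\<bar> + \<epsilon> * K * N"
        by (simp add: K_def algebra_simps)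
      also have "\<dots> \<le> a / 2 * \<bar>dr - L\<bar> + e * a / 2 * N"
        using \<epsilon> by (intro add_mono mult_right_mono) (auto simp: N_def)
      finally have "a * \<bar>dr - L\<bar> \<le> a * (e * N)" by (simp add: algebra_simps)
      then have "\<bar>dr - L\<bar> \<le> e * N" using a by simp
      then show "norm (\<rho> y - \<rho> z - \<rho>' z (y - z)) \<le> e * norm (y - z)"
        by (simp add: dr_def L_def N_def)
    qed
  qed
  moreover have "continuous_on X (\<lambda>z. \<rho>' z h)" for h
    unfolding \<rho>'_def
    by (intro continuous_intros nucont \<rho>cont) (use npos in force)
  ultimately show ?thesis
    using C1_withinI[of X \<rho> \<rho>'] by (simp add: X_def \<rho>_def[abs_def])
qed

end

section \<open>Supporting normals of a convex C1 surface\<close>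

lemma collinear_of_inner_zero:
  fixes a b n m :: "real^3"
  assumes "cross3 a b \<noteq> 0" "n \<bullet> a = 0" "n \<bullet> b = 0" "m \<bullet> a = 0" "m \<bullet> b = 0" "m \<noteq> 0"
  obtains c where "n = c *\<^sub>R m"
proof -
  have *: "\<exists>c. w = c *\<^sub>R cross3 a b" if "w \<bullet> a = 0" "w \<bullet> b = 0" for w
  proof -
    have "cross3 (cross3 a b) w = (a \<bullet> w) *\<^sub>R b - (b \<bullet> w) *\<^sub>R a"
      by (simp add: cross3_simps forall_3)
    then have "cross3 (cross3 a b) w = 0" using that by (simp add: inner_commute)
    then have "collinear {0, cross3 a b, w}" by (simp add: cross_eq_0)
    then show ?thesis using assms(1) by (simp add: collinear_lemma) (metis scaleR_zero_left)
  qed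
  obtain c d where "n = c *\<^sub>R cross3 a b" "m = d *\<^sub>R cross3 a b" using * assms by metis
  then have "n = (c / d) *\<^sub>R m" using assms(6) by auto
  then show thesis by (rule that)
qed

text \<open>Convexity supplies a supporting normal at each boundary point. In a chart the supporting
  functional is extremal, so the normal annihilates the two-dimensional image of the chart
  derivative; this fixes its line, and strict support fixes its sign.\<close>

lemma convex_surface_normal_field:
  fixes \<Omega> :: "(real^3) set"
  assumes \<Omega>: "open \<Omega>" "convex \<Omega>" "bounded \<Omega>" and surf: "C1_surface (frontier \<Omega>)"
  obtains nu :: "real^3 \<Rightarrow> real^3" where
    "\<And>p x. p \<in> frontier \<Omega> \<Longrightarrow> x \<in> \<Omega> \<Longrightarrow> nu p \<bullet> x < nu p \<bullet> p"
    "continuous_on (frontier \<Omega>) nu"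
    "\<And>p. p \<in> frontier \<Omega> \<Longrightarrow> ((\<lambda>M. nu p \<bullet> M) has_derivative (\<lambda>_. 0)) (at p within frontier \<Omega>)"
proof -
  define S where "S = frontier \<Omega>"
  define is_normal where "is_normal p n \<longleftrightarrow> norm n = 1 \<and> (\<forall>x\<in>closure \<Omega>. n \<bullet> x \<le> n \<bullet> p)" for p n :: "real^3"
  have disj: "p \<notin> \<Omega>" "p \<in> closure \<Omega>" if "p \<in> S" for p
    using that \<Omega>(1) by (auto simp: S_def frontier_def interior_open)
  have strict: "n \<bullet> x < n \<bullet> p" if n: "is_normal p n" and x: "x \<in> \<Omega>" for n p x
  proof -
    obtain e where e: "e > 0" "ball x e \<subseteq> \<Omega>" using \<Omega>(1) x by (meson openE)
    \<comment> \<open>An interior point can be pushed a little along the normal without leaving the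
      domain, so the supporting inequality has slack there.\<close>
    have "x + (e/2) *\<^sub>R n \<in> closure \<Omega>"
      using e n closure_subset[of \<Omega>] by (auto simp: is_normal_def dist_norm subset_iff)
    then have "n \<bullet> (x + (e/2) *\<^sub>R n) \<le> n \<bullet> p" using n by (simp add: is_normal_def)
    moreover have "n \<bullet> n = 1" using n by (simp add: is_normal_def norm_eq_1)
    ultimately show ?thesis using e(1) by (simp add: inner_add_right)
  qed
  have ex: "\<exists>n. is_normal p n" if p: "p \<in> S" for p
  proof -
    have "p \<notin> rel_interior (closure \<Omega>)"
      using disj[OF p] \<Omega> by (simp add: convex_rel_interior_closure rel_interior_open)
    then obtain a where a: "a \<noteq> 0" "\<And>y. y \<in> closure \<Omega> \<Longrightarrow> a \<bullet> p \<le> a \<bullet> y"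
      using supporting_hyperplane_rel_boundary[OF convex_closure[OF \<Omega>(2)] disj(2)[OF p]] by metis
    \<comment> \<open>The separating vector \<open>a\<close> points into the domain, hence the
      sign.\<close>
    then have "is_normal p (- sgn a)"
      by (auto simp: is_normal_def norm_sgn sgn_div_norm intro!: mult_left_mono)
    then show ?thesis ..
  qed
  have tangent_unique: "((\<lambda>M. n \<bullet> M) has_derivative (\<lambda>_. 0)) (at p within S) \<and> (\<forall>m. is_normal p m \<longrightarrow> m = n)"
    if p: "p \<in> S" and n: "is_normal p n" for p n
  proof -
    obtain W and V :: "(real^2) set" and f g where
      W: "open W" "p \<in> W" "open V" "homeomorphism V (S \<inter> W) f g" "C1_on V f" "C1_on (S \<inter> W) g"
      using surf p unfolding C1_surface_def C1_diffeomorphic_def S_def by (metis (no_types, lifting))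
    have pSW: "p \<in> S \<inter> W" using p W by simp
    define u where "u = g p"
    have u: "u \<in> V" "f u = p" using W(4) pSW by (auto simp: homeomorphism_def u_def)
    obtain f' where f': "(f has_derivative f') (at u)"
    proof -
      obtain U F and F' :: "real^2 \<Rightarrow> (real^2) \<Rightarrow>\<^sub>L (real^3)" where U: "open U" "u \<in> U" "\<forall>y\<in>U. (F has_derivative blinfun_apply (F' y)) (at y)"
        "\<forall>y\<in>U \<inter> V. F y = f y"
        using bspec[OF W(5)[unfolded C1_on_def] u(1)] by auto
      have "(f has_derivative F' u) (at u)"
        by (rule has_derivative_transform_within_open[of F _ _ _ "U \<inter> V"]) (use U W(3) u(1) in auto)
      then show thesis by (rule that)
    qed
    \<comment> \<open>The inverse chart lives on a surface patch, which is not open, so its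
      derivative is taken relative to the patch.\<close>
    obtain g' where g': "(g has_derivative g') (at p within S \<inter> W)"
    proof -
      obtain U F and F' :: "real^3 \<Rightarrow> (real^3) \<Rightarrow>\<^sub>L (real^2)" where U: "open U" "p \<in> U" "\<forall>y\<in>U. (F has_derivative blinfun_apply (F' y)) (at y)"
        "\<forall>y\<in>U \<inter> (S \<inter> W). F y = g y"
        using bspec[OF W(6)[unfolded C1_on_def] pSW] by auto
      obtain d where d: "d > 0" "ball p d \<subseteq> U" using U by (meson openE)
      have "(F has_derivative F' p) (at p within S \<inter> W)" using U by (auto intro: has_derivative_at_withinI)
      then have "(g has_derivative F' p) (at p within S \<inter> W)"
        by (rule has_derivative_transform_within[OF _ d(1) pSW])
          (use d U(4) in \<open>auto simp: subset_iff dist_commute\<close>)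
      then show thesis by (rule that)
    qed
    have orth: "m \<bullet> f' h = 0" if "is_normal p m" for m h
    proof -
      have "((\<lambda>x. m \<bullet> f x) has_derivative (\<lambda>h. m \<bullet> f' h)) (at u)"
        by (rule bounded_linear.has_derivative[OF bounded_linear_inner_right f'])
      moreover have "m \<bullet> f x \<le> m \<bullet> f u" if "x \<in> V" for x
      proof -
        have "f x \<in> S" using W(4) that by (auto simp: homeomorphism_def)
        then show ?thesis using disj(2) \<open>is_normal p m\<close> u(2) by (simp add: is_normal_def)
      qed
      ultimately have "(\<lambda>h. m \<bullet> f' h) = (\<lambda>_. 0)"
        using differential_zero_maxmin[OF u(1) W(3)] by blast
      then show ?thesis by metis
    qed
    \<comment> \<open>On the patch M = f (g M), so the relative derivative of the height over the
      tangent plane passes through the chart derivative, where \<open>n\<close> vanishes.\<close>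
    have "((\<lambda>M. n \<bullet> f (g M)) has_derivative (\<lambda>h. n \<bullet> f' (g' h))) (at p within S \<inter> W)"
      using f' by (intro bounded_linear.has_derivative[OF bounded_linear_inner_right]
          has_derivative_compose[OF g']) (simp add: u_def)
    then have "((\<lambda>M. n \<bullet> M) has_derivative (\<lambda>_. 0)) (at p within S \<inter> W)"
      using orth[OF n] W(4) pSW
      by (intro has_derivative_transform[OF pSW, of "\<lambda>M. n \<bullet> M" "\<lambda>M. n \<bullet> f (g M)"]) (auto simp: homeomorphism_def)
    moreover have "at p within S \<inter> W = at p within S"
      by (rule at_within_nhd[OF W(2,1)]) auto
    ultimately have T: "((\<lambda>M. n \<bullet> M) has_derivative (\<lambda>_. 0)) (at p within S)" by simp
    have lin: "linear f'" using f' by (simp add: has_derivative_bounded_linear bounded_linear.linear)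
    \<comment> \<open>A left inverse makes the chart derivative injective, so the images of the two
      axes span a plane.\<close>
    have gf: "g' (f' h) = h" for h
    proof -
      have "f ` V \<subseteq> S \<inter> W" using W(4) by (auto simp: homeomorphism_def)
      then have "((\<lambda>x. g (f x)) has_derivative (\<lambda>h. g' (f' h))) (at u within V)"
        using g' u(2) by (intro has_derivative_in_compose[OF has_derivative_at_withinI[OF f']])
          (auto intro: has_derivative_subset)
      then have "((\<lambda>x. x) has_derivative (\<lambda>h. g' (f' h))) (at u within V)"
        by (rule has_derivative_transform[OF u(1), rotated]) (use W(4) in \<open>auto simp: homeomorphism_def\<close>)
      then have "((\<lambda>x. x) has_derivative (\<lambda>h. g' (f' h))) (at u)"
        using at_within_open[OF u(1) W(3)] by simp
      from has_derivative_unique[OF this has_derivative_ident] show ?thesis by metis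
    qed
    have g0: "g' 0 = 0" using g' by (simp add: has_derivative_bounded_linear bounded_linear.linear linear_0)
    define e1 e2 :: "real^2" where "e1 = axis 1 1" and "e2 = axis 2 1"
    have "cross3 (f' e1) (f' e2) \<noteq> 0"
    proof
      assume "cross3 (f' e1) (f' e2) = 0"
      then consider "f' e1 = 0" | "f' e2 = 0" | c where "f' e2 = c *\<^sub>R f' e1"
        by (auto simp: cross_eq_0 collinear_lemma)
      then show False
      proof cases
        case 1 then show ?thesis using gf[of e1] g0 by (simp add: e1_def axis_eq_0_iff)
      next
        case 2 then show ?thesis using gf[of e2] g0 by (simp add: e2_def axis_eq_0_iff)
      next
        case 3
        then have "f' e2 = f' (c *\<^sub>R e1)" by (simp add: linear_scale[OF lin])
        then have "e2 = c *\<^sub>R e1" using gf by metis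
        then have "e2 $ 2 = (c *\<^sub>R e1) $ 2" by simp
        then show ?thesis by (simp add: e1_def e2_def axis_def)
      qed
    qed
    moreover have "n \<noteq> 0" using n by (auto simp: is_normal_def)
    moreover obtain x where x: "x \<in> \<Omega>"
      using disj(2)[OF p] by fastforce
    ultimately have "m = n" if m: "is_normal p m" for m
    proof -
      obtain c where c: "m = c *\<^sub>R n"
        using collinear_of_inner_zero[OF \<open>cross3 (f' e1) (f' e2) \<noteq> 0\<close> orth[OF m] orth[OF m] orth[OF n] orth[OF n] \<open>n \<noteq> 0\<close>] by metis
      \<comment> \<open>Unit length leaves only c = 1 or c = -1; the second would put the interior
        point \<open>x\<close> strictly on both sides of the supporting plane.\<close>
      have "\<bar>c\<bar> = 1" using c m n by (simp add: is_normal_def)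
      moreover have "c * (n \<bullet> (p - x)) > 0" "n \<bullet> (p - x) > 0"
        using strict[OF m x] strict[OF n x] c by (simp_all add: inner_diff_right algebra_simps)
      ultimately show "m = n" using c by (auto simp: zero_less_mult_iff)
    qed
    with T show ?thesis by blast
  qed
  obtain nu where nu: "\<And>p. p \<in> S \<Longrightarrow> is_normal p (nu p)" using ex by metis
  \<comment> \<open>The set of all pairs (boundary point, unit supporting normal) is closed, and by uniqueness it is
    the graph of \<open>nu\<close>.\<close>
  have "continuous_on S nu"
  proof (rule continuous_from_closed_graph)
    show "compact (cball (0::real^3) 1)" by simp
    show "nu \<in> S \<rightarrow> cball 0 1" using nu by (auto simp: is_normal_def)
    have "(\<lambda>x. (x, nu x)) ` S = (S \<times> sphere 0 1) \<inter> (\<Inter>x\<in>closure \<Omega>. {z. snd z \<bullet> x \<le> snd z \<bullet> fst z})"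
      using nu tangent_unique by (auto simp: is_normal_def image_iff)
    moreover have "closed (S \<times> sphere (0::real^3) 1)"
      by (intro closed_Times) (auto simp: S_def)
    moreover have "closed {z. snd z \<bullet> x \<le> snd z \<bullet> (fst z :: real^3)}" for x
      by (intro closed_Collect_le continuous_intros)
    ultimately show "closed ((\<lambda>x. (x, nu x)) ` S)"
      by (simp add: closed_Int closed_INT)
  qed
  then show thesis
    using that[of nu] nu strict tangent_unique by (metis S_def)
qed

section \<open>Parameter integrals and the maximum principle\<close>

text \<open>Squaring removes the corner: the difference quotient at 0 is at most |y| in absolute
  value. This gives a C1 cut-off.\<close>

lemma has_real_derivative_max_square:
  "((\<lambda>y. (max 0 y)\<^sup>2) has_real_derivative 2 * max 0 y) (at (y::real))"
proof -
  consider "y < 0" | "y > 0" | "y = 0" by linarith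
  then show ?thesis
  proof cases
    case 1
    have "((\<lambda>_. 0) has_real_derivative 2 * max 0 y) (at y)" using 1 by simp
    then show ?thesis
      by (rule has_field_derivative_transform_within_open[of _ _ _ "{..<0}"]) (use 1 in auto)
  next
    case 2
    have "((\<lambda>y. y\<^sup>2) has_real_derivative 2 * max 0 y) (at y)"
      using 2 by (auto intro!: derivative_eq_intros)
    then show ?thesis
      by (rule has_field_derivative_transform_within_open[of _ _ _ "{0<..}"]) (use 2 in auto)
  next
    case 3
    have "((\<lambda>y::real. (max 0 y)\<^sup>2 / y) \<longlongrightarrow> 0) (at 0)"
    proof (rule Lim_null_comparison)
      show "\<forall>\<^sub>F y in at 0. norm ((max 0 y)\<^sup>2 / y) \<le> \<bar>y\<bar>"
        by (auto simp: eventually_at_filter max_def power2_eq_square)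
      show "((\<lambda>y::real. \<bar>y\<bar>) \<longlongrightarrow> 0) (at 0)" by (auto intro!: tendsto_eq_intros)
    qed
    then show ?thesis using 3 by (simp add: has_field_derivative_iff)
  qed
qed

text \<open>Removing the singularity yields a C1 function on a convex domain, as needed to differentiate
  under the integral sign.\<close>

lemma C1_inverse_norm_extension:
  assumes "\<delta> > 0"
  obtains h :: "'a::euclidean_space \<Rightarrow> real"
  where "C1_within UNIV h" "\<And>x. norm x \<ge> \<delta> \<Longrightarrow> h x = inverse (norm x)"
proof -
  define a where "a = \<delta>\<^sup>2"
  have a: "a > 0" using assms by (simp add: a_def)
  \<comment> \<open>A positive C1 function that is the identity above \<open>a\<close>. Since
    \<open>a\<close> is the square of \<open>\<delta>\<close>, the function
    \<open>inverse (sqrt (\<psi> (x \<bullet> x)))\<close> is the required extension.\<close>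
  define \<psi> where "\<psi> u = u + inverse a * (max 0 (a - u))\<^sup>2" for u :: real
  have pos: "\<psi> u > 0" for u
  proof (cases "u > 0")
    case False
    \<comment> \<open>Dropping the nonnegative term \<open>u * (u - a)\<close> leaves a correction
      of at least \<open>a - u\<close>, so that \<open>\<psi> u\<close> is at least \<open>a\<close>
      here.\<close>
    then have "(max 0 (a - u))\<^sup>2 = a\<^sup>2 - a * u + u * (u - a)" using a
      by (simp add: max_def power2_eq_square algebra_simps)
    moreover have "u * (u - a) \<ge> 0" using False a by (simp add: mult_nonpos_nonpos)
    ultimately have "inverse a * (max 0 (a - u))\<^sup>2 \<ge> inverse a * (a\<^sup>2 - a * u)" using a by simp
    also have "inverse a * (a\<^sup>2 - a * u) = a - u" using a by (simp add: power2_eq_square field_simps)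
    finally show ?thesis using a by (simp add: \<psi>_def)
  qed (use a in \<open>simp add: \<psi>_def add_pos_nonneg\<close>)
  have sq: "C1_within UNIV (\<lambda>u::real. (max 0 u)\<^sup>2)"
    by (rule C1_within_real_derivative[of _ _ "\<lambda>y. 2 * max 0 y"])
      (auto simp flip: has_real_derivative_iff_has_vector_derivative
        intro!: has_real_derivative_max_square continuous_intros)
  have "C1_within UNIV (\<lambda>x::'a. \<psi> (x \<bullet> x))"
    unfolding \<psi>_def
    by (intro C1_within_add C1_within_mult C1_within_const
        C1_within_bilinear[OF bounded_bilinear_inner] C1_within_ident
        C1_within_compose[OF _ sq] C1_within_diff) auto
  moreover have "C1_within {0<..} sqrt"
    by (rule C1_within_real_derivative[of _ _ "\<lambda>x. inverse (sqrt x) / 2"])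
      (auto simp flip: has_real_derivative_iff_has_vector_derivative
        intro!: DERIV_subset[OF DERIV_real_sqrt] continuous_intros)
  ultimately have "C1_within UNIV (\<lambda>x::'a. sqrt (\<psi> (x \<bullet> x)))"
    by (rule C1_within_compose) (use pos in auto)
  then have "C1_within UNIV (\<lambda>x::'a. inverse (sqrt (\<psi> (x \<bullet> x))))"
    by (rule C1_within_inverse) (use pos in \<open>simp add: less_imp_neq[THEN not_sym]\<close>)
  moreover have "inverse (sqrt (\<psi> (x \<bullet> x))) = inverse (norm x)" if "norm x \<ge> \<delta>" for x :: 'a
  proof -
    have "a \<le> x \<bullet> x" using power_mono[OF that, of 2] assms by (simp add: a_def power2_norm_eq_inner)
    then have "\<psi> (x \<bullet> x) = x \<bullet> x" by (simp add: \<psi>_def)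
    then show ?thesis by (simp add: norm_eq_sqrt_inner)
  qed
  ultimately show thesis by (rule that)
qed

text \<open>Rescaling \<open>\<integral>\<^sub>0\<^sup>t f\<close> to the unit interval makes it a parameter integral over a fixed domain, so
  that it is C1 jointly in \<open>t\<close> and in the parameters of \<open>f\<close>.\<close>

definition scaled_integral :: "(real \<Rightarrow> real) \<Rightarrow> real \<Rightarrow> real" where
  "scaled_integral f t = integral {0..1} (\<lambda>s. t * f (t * s))"

text \<open>The spatial parameter ranges over the whole space, so that the parameter set is convex;
  the surface itself is not.\<close>

lemma C1_within_scaled_integral:
  assumes C: "C1_within {0..} C" and h: "C1_within UNIV h"
  shows "C1_within ({0..} \<times> UNIV) (\<lambda>p. scaled_integral (\<lambda>s. h (snd p - C s)) (fst p))"
proof -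
  have "C1_within (({0..} \<times> UNIV) \<times> {0..1}) (\<lambda>z. fst (fst z) * h (snd (fst z) - C (fst (fst z) * snd z)))"
    by (intro C1_within_mult C1_within_compose[OF _ h] C1_within_compose[OF _ C] C1_within_diff
        C1_within_fst_compose C1_within_snd_compose C1_within_fst C1_within_snd) auto
  then show ?thesis
    unfolding scaled_integral_def
    using C1_within_integral[of "{0..} \<times> UNIV" "\<lambda>z. fst (fst z) * h (snd (fst z) - C (fst (fst z) * snd z))"]
    by (simp add: convex_Times)
qed

lemma scaled_integral_eq:
  assumes "continuous_on {0..} f" "t \<ge> 0"
  shows "scaled_integral f t = integral {0..t} f"
proof -
  have "((\<lambda>s. t *\<^sub>R f (t * s)) has_integral integral {t * 0..t * 1} f) {0..1}"
    by (rule has_integral_substitution[of 0 1 "\<lambda>s. t * s" 0 t])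
      (use assms in \<open>auto intro!: derivative_eq_intros mult_left_le continuous_on_subset[OF assms(1)]\<close>)
  from integral_unique[OF this] show ?thesis by (simp add: scaled_integral_def)
qed

lemma scaled_integral_has_real_derivative:
  assumes f: "continuous_on {0..} f" and t: "t \<ge> 0"
  shows "(scaled_integral f has_real_derivative f t) (at t within {0..})"
proof -
  have "((\<lambda>s. integral {0..s} f) has_real_derivative f t) (at t within {0..t+1})"
    by (rule integral_has_real_derivative) (use t in \<open>auto intro: continuous_on_subset[OF f]\<close>)
  \<comment> \<open>The end point t + 1 leaves room to the right of t, so the filter is that of the
    half-line, one-sided only at t = 0.\<close>
  moreover have "at t within {0..t+1} = at t within {0..}"
    by (rule at_within_nhd[of _ "{..<t+1}"]) auto
  ultimately have "((\<lambda>s. integral {0..s} f) has_real_derivative f t) (at t within {0..})" by simp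
  then show ?thesis
    by (rule has_field_derivative_transform_within[OF _ zero_less_one])
      (use t scaled_integral_eq[OF f] in auto)
qed

section \<open>Comparison of two solutions\<close>

lemma has_sphere_gradient_diff:
  assumes "has_sphere_gradient h1 g1 \<eta>" "has_sphere_gradient h2 g2 \<eta>"
  shows "has_sphere_gradient (\<lambda>x. h1 x - h2 x) (g1 - g2) \<eta>"
  using assms has_derivative_diff[of h1 "\<lambda>x. g1 \<bullet> x" _ h2 "\<lambda>x. g2 \<bullet> x"]
  unfolding has_sphere_gradient_def inner_diff_left by simp

lemma sphere_gradient_at_max:
  assumes g: "has_sphere_gradient h g \<eta>" and \<eta>: "\<eta> \<in> sphere 0 1"
    and max: "\<And>x. x \<in> sphere 0 1 \<Longrightarrow> h x \<le> h \<eta>"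
  shows "g = 0"
proof -
  have "sgn \<eta> = \<eta>" using \<eta> by (simp add: sgn_div_norm)
  then have "\<forall>x\<in>-{0}. h (sgn x) \<le> h (sgn \<eta>)" using max by (simp add: norm_sgn)
  moreover have "\<eta> \<in> -{0}" using \<eta> by auto
  ultimately have "(\<lambda>x. g \<bullet> x) = (\<lambda>_. 0)"
    using differential_zero_maxmin[OF _ _ has_sphere_gradient_sgn[OF g \<eta>], of "-{0}"]
    by (simp add: open_Compl)
  then show ?thesis by (metis inner_eq_zero_iff)
qed

text \<open>Continuity on a compact time slab provides the maximum point, and at that point existing
  derivatives are enough. Applying the inequality in both directions gives uniqueness.\<close>

lemma depth_observer_solution_le:
  assumes E: "depth_observer_solution k v \<omega> \<Gamma> D0 E" and F: "depth_observer_solution k v \<omega> \<Gamma> D0 F"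
    and k: "k \<ge> 0" and \<Gamma>: "\<And>t \<eta>. t \<ge> 0 \<Longrightarrow> \<eta> \<in> sphere 0 1 \<Longrightarrow> \<Gamma> t \<eta> \<ge> 0"
    and T: "T \<ge> 0" and \<eta>: "\<eta> \<in> sphere 0 1"
  shows "E T \<eta> \<le> F T \<eta>"
proof (rule ccontr)
  assume neg: "\<not> E T \<eta> \<le> F T \<eta>"
  \<comment> \<open>The penalty \<open>\<epsilon> t\<close> forces a strictly positive time derivative at a positive maximum, where the
    transport term vanishes and the damping term has the wrong sign.\<close>
  define \<epsilon> where "\<epsilon> = (E T \<eta> - F T \<eta>) / (T + 1)"
  have \<epsilon>: "\<epsilon> > 0" using neg T by (simp add: \<epsilon>_def)
  define w where "w t x = E t x - F t x - \<epsilon> * t" for t x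
  \<comment> \<open>By the choice of the penalty this value is \<open>\<epsilon>\<close>
    itself.\<close>
  have pos: "w T \<eta> > 0" using neg T by (simp add: w_def \<epsilon>_def field_simps)
  let ?Q = "{0..T} \<times> sphere (0::real^3) 1"
  have "continuous_on ?Q (\<lambda>z. w (fst z) (snd z))"
  proof -
    have "continuous_on ?Q (\<lambda>(t, \<eta>). E t \<eta>)" "continuous_on ?Q (\<lambda>(t, \<eta>). F t \<eta>)"
      using E F unfolding depth_observer_solution_def
      by (auto intro: continuous_on_subset[of "{0..} \<times> sphere 0 1"])
    then show ?thesis unfolding w_def by (intro continuous_intros) (simp_all add: case_prod_unfold)
  qed
  then obtain z where z: "z \<in> ?Q" "\<And>y. y \<in> ?Q \<Longrightarrow> w (fst y) (snd y) \<le> w (fst z) (snd z)"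
    using continuous_attains_sup[of ?Q "\<lambda>z. w (fst z) (snd z)"] T \<eta> by (auto simp: compact_Times)
  obtain t x where tx: "z = (t, x)" by force
  then have t: "0 \<le> t" "t \<le> T" and x: "x \<in> sphere 0 1" using z(1) by auto
  have max: "w s y \<le> w t x" if "0 \<le> s" "s \<le> T" "y \<in> sphere 0 1" for s y
    using z(2)[of "(s, y)"] that tx by simp
  have wpos: "w t x > 0" using max[of T \<eta>] pos T \<eta> by simp
  have "w 0 x = 0" using E F x by (simp add: w_def depth_observer_solution_def)
  then have "t > 0" using wpos t by (cases "t = 0") auto
  obtain g1 g2 where g: "has_sphere_gradient (E t) g1 x" "has_sphere_gradient (F t) g2 x"
    using E F t x unfolding depth_observer_solution_def by metis
  have "g1 - g2 = 0"
    by (rule sphere_gradient_at_max[OF has_sphere_gradient_diff[OF g] x])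
      (use max[of t] t in \<open>simp add: w_def\<close>)
  then have g2: "sphere_gradient (E t) x = sphere_gradient (F t) x"
    using sphere_gradient_eq[OF g(1) x] sphere_gradient_eq[OF g(2) x] by simp
  have "((\<lambda>s. E s x - F s x - \<epsilon> * s) has_real_derivative
      (- (sphere_gradient (E t) x \<bullet> (flow_f \<omega> t x + \<Gamma> t x *\<^sub>R flow_g v t x))
           - v t \<bullet> x + k * (1 - E t x * \<Gamma> t x)) -
      (- (sphere_gradient (F t) x \<bullet> (flow_f \<omega> t x + \<Gamma> t x *\<^sub>R flow_g v t x))
           - v t \<bullet> x + k * (1 - F t x * \<Gamma> t x)) - \<epsilon>) (at t within {0..})"
    by (intro DERIV_diff)
      (use E F t x in \<open>auto simp: depth_observer_solution_def intro!: derivative_eq_intros\<close>)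
  then have D: "((\<lambda>s. w s x) has_real_derivative - (k * \<Gamma> t x * (E t x - F t x)) - \<epsilon>) (at t within {0..})"
    by (simp add: w_def[abs_def] g2 algebra_simps)
  have "k * \<Gamma> t x * (E t x - F t x) \<ge> 0"
  proof -
    have "E t x - F t x \<ge> 0" using wpos mult_nonneg_nonneg[of \<epsilon> t] t(1) \<epsilon> unfolding w_def by linarith
    then show ?thesis using k \<Gamma>[OF t(1) x] by simp
  qed
  then have "- (k * \<Gamma> t x * (E t x - F t x)) - \<epsilon> < 0" using \<epsilon> by linarith
  \<comment> \<open>The maximum may sit at the final time, so only earlier times are compared; they
    exist because t > 0.\<close>
  from has_real_derivative_neg_dec_left[OF D this] obtain d where d: "d > 0"
    "\<And>h. h > 0 \<Longrightarrow> t - h \<in> {0..} \<Longrightarrow> h < d \<Longrightarrow> w t x < w (t - h) x" by blast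
  have "w t x < w (t - min t (d/2)) x" using d \<open>t > 0\<close> by (intro d) auto
  moreover have "t - min t (d/2) \<le> T" using t(2) d(1) \<open>t > 0\<close> by (simp add: min_def)
  then have "w (t - min t (d/2)) x \<le> w t x" by (intro max x) auto
  ultimately show False by simp
qed

section \<open>Transport along fixed scene points\<close>

text \<open>Ensures that one-sided derivatives are unique, also at t = 0.\<close>

lemma at_within_Ici_neq_bot: "(t::real) \<ge> 0 \<Longrightarrow> at t within {0..} \<noteq> bot"
proof -
  assume "t \<ge> 0"
  then have "at_right t \<le> at t within {0..}" by (intro at_le) auto
  then show ?thesis using trivial_limit_at_right_real[of t] by (metis bot.extremum_uniqueI)
qed

locale moving_camera =
  fixes \<Omega> S :: "(real^3) set" and C v \<omega> :: "real \<Rightarrow> real^3" and q :: "real \<Rightarrow> quaternion"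
  assumes scene: "convex_scene \<Omega> S" and camera: "camera_motion \<Omega> C q v \<omega>"
begin

sublocale convex_domain \<Omega>
  using scene by unfold_locales (auto simp: convex_scene_def)

lemma S_eq: "S = frontier \<Omega>"
  using scene by (simp add: convex_scene_def)

lemma C_inside: "t \<ge> 0 \<Longrightarrow> C t \<in> \<Omega>" and norm_q: "t \<ge> 0 \<Longrightarrow> norm (q t) = 1"
  and C_deriv: "t \<ge> 0 \<Longrightarrow> (C has_vector_derivative qrot (q t) (v t)) (at t within {0..})"
  and q_deriv: "t \<ge> 0 \<Longrightarrow> (q has_vector_derivative (1/2) *\<^sub>R qmult (q t) (qim (\<omega> t))) (at t within {0..})"
  and v_cont: "continuous_on {0..} v" and \<omega>_cont: "continuous_on {0..} \<omega>"
  using camera by (auto simp: camera_motion_def)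

lemma C_not_in_S: "t \<ge> 0 \<Longrightarrow> M \<in> S \<Longrightarrow> M \<noteq> C t"
  using C_inside frontier_disjoint S_eq by blast

lemma C1_within_q: "C1_within {0..} q"
proof -
  have "continuous_on {0..} q"
    using q_deriv by (auto simp: continuous_on_eq_continuous_within intro: has_vector_derivative_continuous)
  then show ?thesis
    by (intro C1_within_real_derivative[where f' = "\<lambda>t. (1/2) *\<^sub>R qmult (q t) (qim (\<omega> t))"] q_deriv
        continuous_on_scaleR continuous_on_const bounded_bilinear.continuous_on[OF bounded_bilinear_qmult]
        bounded_linear.continuous_on[OF bounded_linear_qim] \<omega>_cont) auto
qed

lemma C1_within_C: "C1_within {0..} C"
proof (rule C1_within_real_derivative[where f' = "\<lambda>t. qrot (q t) (v t)"])
  have "continuous_on UNIV (\<lambda>z. qrot (fst z) (snd z))"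
    by (intro C1_within_continuous_on C1_within_qrot C1_within_fst C1_within_snd)
  then show "continuous_on {0..} (\<lambda>t. qrot (q t) (v t))"
    using continuous_on_compose2[of UNIV "\<lambda>z. qrot (fst z) (snd z)" "{0..}" "\<lambda>t. (q t, v t)"]
      C1_within_continuous_on[OF C1_within_q] v_cont by (auto intro: continuous_on_Pair)
qed (use C_deriv in auto)

text \<open>Camera coordinates of M, left unnormalised: the direction is the pixel and the length is
  the depth.\<close>

definition pixel :: "real \<Rightarrow> real^3 \<Rightarrow> real^3" where
  "pixel t M = qrot (qconj (q t)) (M - C t)"

text \<open>Unlike \<open>seen_point\<close>, this is meaningful for every nonzero direction, so it
  can be differentiated in the ambient space.\<close>

definition scene_point :: "real \<Rightarrow> real^3 \<Rightarrow> real^3" where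
  "scene_point t \<eta> = C t + radial \<Omega> (C t) (qrot (q t) \<eta>) *\<^sub>R qrot (q t) \<eta>"

lemma norm_pixel: "t \<ge> 0 \<Longrightarrow> norm (pixel t M) = norm (M - C t)"
  by (simp add: pixel_def norm_qrot norm_q)

lemma pixel_nonzero: "t \<ge> 0 \<Longrightarrow> M \<in> S \<Longrightarrow> pixel t M \<noteq> 0"
  using norm_pixel[of t M] C_not_in_S[of t M] by auto

lemma qrot_nonzero: "t \<ge> 0 \<Longrightarrow> \<eta> \<noteq> 0 \<Longrightarrow> qrot (q t) \<eta> \<noteq> 0"
  using norm_qrot[OF norm_q] by (metis norm_eq_zero)

lemma scene_point_in_S:
  assumes "t \<ge> 0" "\<eta> \<noteq> 0" shows "scene_point t \<eta> \<in> S"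
  using radial_hits(2)[OF C_inside qrot_nonzero] assms by (simp add: scene_point_def S_eq)

text \<open>Together with \<open>pixel_scene_point\<close>, a bijection at each time between surface
  points and directions up to positive scaling.\<close>

lemma scene_point_pixel:
  assumes "t \<ge> 0" "M \<in> S" "a > 0"
  shows "scene_point t (a *\<^sub>R pixel t M) = M"
  unfolding scene_point_def
  by (rule frontier_point_via_radial[where a = a])
    (use assms in \<open>auto simp: C_inside S_eq qrot_scaleR pixel_def qrot_qrot_qconj norm_q\<close>)

lemma pixel_scene_point:
  assumes "t \<ge> 0" "\<eta> \<noteq> 0"
  shows "pixel t (scene_point t \<eta>) = norm (scene_point t \<eta> - C t) *\<^sub>R sgn \<eta>"
proof -
  let ?r = "radial \<Omega> (C t) (qrot (q t) \<eta>)"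
  have "pixel t (scene_point t \<eta>) = ?r *\<^sub>R \<eta>"
    by (simp add: pixel_def scene_point_def qrot_scaleR qrot_qconj_qrot norm_q assms)
  moreover have "norm (scene_point t \<eta> - C t) = ?r * norm \<eta>"
    using radial_hits(1)[OF C_inside[OF assms(1)] qrot_nonzero[OF assms]] assms(1)
    by (simp add: scene_point_def norm_qrot norm_q)
  ultimately show ?thesis using assms by (simp add: sgn_div_norm)
qed

lemma scene_point_scaleR:
  assumes "t \<ge> 0" "\<eta> \<noteq> 0" "c > 0"
  shows "scene_point t (c *\<^sub>R \<eta>) = scene_point t \<eta>"
proof -
  let ?M = "scene_point t \<eta>" and ?D = "norm (scene_point t \<eta> - C t)"
  have D: "?D > 0" using C_not_in_S[OF assms(1) scene_point_in_S[OF assms(1,2)]] by simp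
  have "c *\<^sub>R \<eta> = (c * norm \<eta> / ?D) *\<^sub>R pixel t ?M"
    using D assms by (simp add: pixel_scene_point sgn_div_norm)
  then show ?thesis
    using scene_point_pixel[OF assms(1) scene_point_in_S[OF assms(1,2)], of "c * norm \<eta> / ?D"] D assms by simp
qed

lemma seen_point_eq:
  assumes t: "t \<ge> 0" and \<eta>: "\<eta> \<in> sphere 0 1"
  shows "seen_point S (C t) (q t) \<eta> = scene_point t \<eta>"
  unfolding seen_point_def
proof (rule the_equality)
  have nz: "\<eta> \<noteq> 0" and s: "sgn \<eta> = \<eta>" using \<eta> by (auto simp: sgn_div_norm)
  let ?D = "norm (scene_point t \<eta> - C t)"
  have D: "?D > 0" using C_not_in_S[OF t scene_point_in_S[OF t nz]] by simp
  have "qrot (q t) (pixel t (scene_point t \<eta>)) = scene_point t \<eta> - C t"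
    using t by (simp add: pixel_def qrot_qrot_qconj norm_q)
  then have "?D *\<^sub>R qrot (q t) \<eta> = scene_point t \<eta> - C t"
    using pixel_scene_point[OF t nz] s by (simp add: qrot_scaleR)
  then have "qrot (q t) \<eta> = (scene_point t \<eta> - C t) /\<^sub>R ?D"
    using D by (metis inverse_inverse_eq less_irrefl real_vector_affinity_eq scaleR_one scaleR_scaleR
        right_inverse mult.commute)
  then show "scene_point t \<eta> \<in> S \<and> qrot (q t) \<eta> = (scene_point t \<eta> - C t) /\<^sub>R ?D"
    using scene_point_in_S[OF t nz] by simp
  fix M assume M: "M \<in> S \<and> qrot (q t) \<eta> = (M - C t) /\<^sub>R norm (M - C t)"
  then have "\<eta> = inverse (norm (M - C t)) *\<^sub>R pixel t M"
    using qrot_qconj_qrot[OF norm_q[OF t], of \<eta>] by (simp add: pixel_def qrot_scaleR)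
  then show "M = scene_point t \<eta>"
    using scene_point_pixel[OF t, of M "inverse (norm (M - C t))"] M C_not_in_S[OF t, of M] by simp
qed

lemma depth_eq: "t \<ge> 0 \<Longrightarrow> \<eta> \<in> sphere 0 1 \<Longrightarrow> depth S C q t \<eta> = norm (scene_point t \<eta> - C t)"
  by (simp add: depth_def seen_point_eq)

lemma inv_depth_eq:
  "t \<ge> 0 \<Longrightarrow> \<eta> \<in> sphere 0 1 \<Longrightarrow> inv_depth S C q t \<eta> = inverse (norm (scene_point t \<eta> - C t))"
  by (simp add: inv_depth_def depth_eq inverse_eq_divide)

lemma depth_pos: "t \<ge> 0 \<Longrightarrow> \<eta> \<in> sphere 0 1 \<Longrightarrow> norm (scene_point t \<eta> - C t) > 0"
  using C_not_in_S scene_point_in_S sphere_nonzero by (metis right_minus_eq zero_less_norm_iff)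

lemma C1_within_scene_point: "C1_within ({0..} \<times> -{0}) (\<lambda>z. scene_point (fst z) (snd z))"
proof -
  have surf: "C1_surface (frontier \<Omega>)" using scene unfolding convex_scene_def by blast
  obtain nu :: "real^3 \<Rightarrow> real^3" where
    nu: "\<And>p x. p \<in> frontier \<Omega> \<Longrightarrow> x \<in> \<Omega> \<Longrightarrow> nu p \<bullet> x < nu p \<bullet> p"
    "continuous_on (frontier \<Omega>) nu"
    "\<And>p. p \<in> frontier \<Omega> \<Longrightarrow> ((\<lambda>M. nu p \<bullet> M) has_derivative (\<lambda>_. 0)) (at p within frontier \<Omega>)"
    using convex_surface_normal_field[OF open_domain convex_domain bounded_domain surf] by blast
  have C: "C1_within ({0..} \<times> -{0::real^3}) (\<lambda>z. C (fst z))"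
    by (rule C1_within_compose[OF C1_within_fst C1_within_C]) auto
  have R: "C1_within ({0..} \<times> -{0::real^3}) (\<lambda>z. qrot (q (fst z)) (snd z))"
    by (rule C1_within_qrot[OF C1_within_compose[OF C1_within_fst C1_within_q] C1_within_snd]) auto
  have "C1_within ({0..} \<times> -{0::real^3}) (\<lambda>z. radial \<Omega> (C (fst z)) (qrot (q (fst z)) (snd z)))"
  proof -
    have "(\<lambda>z. (C (fst z), qrot (q (fst z)) (snd z))) ` ({0..} \<times> -{0}) \<subseteq> \<Omega> \<times> -{0}"
      using C_inside qrot_nonzero by (simp add: image_subset_iff)
    from C1_within_compose[OF C1_within_Pair[OF C R] radial_C1_within[OF nu] this]
    show ?thesis by simp
  qed
  then show ?thesis
    unfolding scene_point_def by (intro C1_within_add C1_within_scaleR C R)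
qed

text \<open>The scale \<open>\<Gamma>\<close> is frozen at time t, so the curve meets the sphere at
  t but need not stay on it. Its velocity differs from f + \<open>\<Gamma>\<close> g by a multiple
  of \<open>\<eta>\<close>, invisible to fields constant along rays, and no normalisation has to be
  differentiated.\<close>

lemma pixel_characteristic:
  assumes t: "t \<ge> 0" and \<eta>: "\<eta> \<in> sphere 0 1"
  defines "\<Gamma> \<equiv> inv_depth S C q t \<eta>" and "M \<equiv> scene_point t \<eta>"
  shows "\<Gamma> *\<^sub>R pixel t M = \<eta>"
    and "((\<lambda>s. \<Gamma> *\<^sub>R pixel s M) has_vector_derivative cross3 \<eta> (\<omega> t) - \<Gamma> *\<^sub>R v t) (at t within {0..})"
proof -
  have nz: "\<eta> \<noteq> 0" and s: "sgn \<eta> = \<eta>" using \<eta> by (auto simp: sgn_div_norm)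
  have inv: "\<Gamma> * norm (M - C t) = 1"
    using depth_pos[OF t \<eta>] by (simp add: \<Gamma>_def M_def inv_depth_eq[OF t \<eta>])
  then show *: "\<Gamma> *\<^sub>R pixel t M = \<eta>"
    using pixel_scene_point[OF t nz] s by (simp add: M_def)
  have "((\<lambda>s. M - C s) has_vector_derivative 0 - qrot (q t) (v t)) (at t within {0..})"
    by (rule has_vector_derivative_diff[OF has_vector_derivative_const C_deriv[OF t]])
  from qrot_qconj_has_vector_derivative[OF q_deriv[OF t] this]
  have "((\<lambda>s. pixel s M) has_vector_derivative cross3 (pixel t M) (\<omega> t) - v t) (at t within {0..})"
    using linear_neg[OF bounded_linear.linear[OF bounded_linear_qrot]]
    by (simp add: pixel_def qrot_qconj_qrot[OF norm_q[OF t]])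
  from bounded_linear.has_vector_derivative[OF bounded_linear_scaleR_right[of \<Gamma>] this]
  show "((\<lambda>s. \<Gamma> *\<^sub>R pixel s M) has_vector_derivative cross3 \<eta> (\<omega> t) - \<Gamma> *\<^sub>R v t) (at t within {0..})"
    by (simp add: scaleR_diff_right cross_mult_left[symmetric] *)
qed

section \<open>Fields constant along rays and their time derivative\<close>

context
  fixes u :: "real \<Rightarrow> real^3 \<Rightarrow> real"
  assumes C1: "C1_within ({0..} \<times> -{0}) (\<lambda>z. u (fst z) (snd z))"
    and hom: "\<And>t \<eta> c. t \<ge> 0 \<Longrightarrow> \<eta> \<noteq> 0 \<Longrightarrow> c > 0 \<Longrightarrow> u t (c *\<^sub>R \<eta>) = u t \<eta>"
begin

lemma homogeneous_total_derivative:
  obtains u' where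
    "\<And>t \<eta>. t \<ge> 0 \<Longrightarrow> \<eta> \<in> sphere 0 1 \<Longrightarrow>
       ((\<lambda>z. u (fst z) (snd z)) has_derivative u' (t, \<eta>)) (at (t, \<eta>) within {0..} \<times> -{0})"
    "\<And>t \<eta>. t \<ge> 0 \<Longrightarrow> \<eta> \<in> sphere 0 1 \<Longrightarrow> has_sphere_gradient (u t) (sphere_gradient (u t) \<eta>) \<eta>"
    "\<And>t \<eta> x. t \<ge> 0 \<Longrightarrow> \<eta> \<in> sphere 0 1 \<Longrightarrow> sphere_gradient (u t) \<eta> \<bullet> x = u' (t, \<eta>) (0, x)"
    "continuous_on ({0..} \<times> sphere 0 1) (\<lambda>(t, \<eta>). sphere_gradient (u t) \<eta>)"
proof -
  obtain u' where u': "\<And>z. z \<in> {0..} \<times> -{0} \<Longrightarrow>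
      ((\<lambda>z. u (fst z) (snd z)) has_derivative u' z) (at z within {0..} \<times> -{0})"
    "\<And>h. continuous_on ({0..} \<times> -{0}) (\<lambda>z. u' z h)"
    by (rule C1_withinE[OF C1]) blast
  define G where "G z = (\<Sum>b\<in>Basis. u' z (0, b) *\<^sub>R b)" for z :: "real \<times> (real^3)"
  have G: "has_sphere_gradient (u t) (G (t, \<eta>)) \<eta> \<and> (\<forall>x. G (t, \<eta>) \<bullet> x = u' (t, \<eta>) (0, x))"
    if "t \<ge> 0" "\<eta> \<in> sphere 0 1" for t \<eta>
  proof -
    have nz: "\<eta> \<in> -{0}" using sphere_nonzero[OF that(2)] by simp
    have "((\<lambda>y. (t, y)) has_derivative (\<lambda>h. (0, h))) (at \<eta> within -{0})"
      by (auto intro!: derivative_eq_intros)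
    from has_derivative_in_compose2[OF u'(1) _ nz this]
    have "(u t has_derivative (\<lambda>h. u' (t, \<eta>) (0, h))) (at \<eta> within -{0})"
      using that(1) by (simp add: image_subset_iff)
    moreover have "at \<eta> within -{0} = at \<eta>"
      by (rule at_within_open[OF nz]) (simp add: open_Compl)
    ultimately have d: "(u t has_derivative (\<lambda>h. u' (t, \<eta>) (0, h))) (at \<eta>)" by metis
    have "u t (c *\<^sub>R \<eta>) = u t \<eta>" if "c > 0" for c
      using hom[OF \<open>t \<ge> 0\<close> _ that, of \<eta>] nz by simp
    from has_sphere_gradient_homogeneous[OF d this] show ?thesis by (simp add: G_def)
  qed
  have eq: "sphere_gradient (u t) \<eta> = G (t, \<eta>)" if "t \<ge> 0" "\<eta> \<in> sphere 0 1" for t \<eta>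
    using sphere_gradient_eq[OF _ that(2)] G[OF that] by blast
  have "continuous_on ({0..} \<times> -{0}) G"
    unfolding G_def by (intro continuous_intros u'(2))
  then have "continuous_on ({0..} \<times> sphere 0 1) G"
    by (rule continuous_on_subset) auto
  then have "continuous_on ({0..} \<times> sphere 0 1) (\<lambda>(t, \<eta>). sphere_gradient (u t) \<eta>)"
    by (rule continuous_on_eq) (auto simp: eq)
  with u' G eq show thesis
    by (intro that[of u']) (simp_all add: sphere_nonzero)
qed

lemma homogeneous_C1_on_sphere:
  assumes "t \<ge> 0" shows "C1_on (sphere 0 1) (u t)"
proof (rule C1_on_openI)
  have "C1_within (-{0}) (\<lambda>y. (\<lambda>z. u (fst z) (snd z)) (t, y))"
    by (rule C1_within_compose[OF C1_within_Pair[OF C1_within_const C1_within_ident] C1])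
      (use assms in auto)
  then show "C1_within (-{0}) (u t)" by simp
qed (auto simp: open_Compl)

text \<open>The field is already known to be differentiable, so the chain rule along a single curve
  through (t, \<open>\<eta>\<close>) determines its time derivative: subtract from \<open>r\<close>
  the gradient paired with the velocity of the curve. The radial part of that velocity drops out
  because the gradient is tangent.\<close>

lemma time_derivative_from_characteristic:
  assumes t: "t \<ge> 0" and \<eta>: "\<eta> \<in> sphere 0 1"
    and along: "((\<lambda>s. u s (inv_depth S C q t \<eta> *\<^sub>R pixel s (scene_point t \<eta>)))
                  has_real_derivative r) (at t within {0..})"
  shows "((\<lambda>s. u s \<eta>) has_real_derivative
            r - sphere_gradient (u t) \<eta> \<bullet> (flow_f \<omega> t \<eta> + inv_depth S C q t \<eta> *\<^sub>R flow_g v t \<eta>))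
          (at t within {0..})"
proof -
  obtain u' where u': "\<And>t \<eta>. t \<ge> 0 \<Longrightarrow> \<eta> \<in> sphere 0 1 \<Longrightarrow>
       ((\<lambda>z. u (fst z) (snd z)) has_derivative u' (t, \<eta>)) (at (t, \<eta>) within {0..} \<times> -{0})"
    and grads: "\<And>t \<eta>. t \<ge> 0 \<Longrightarrow> \<eta> \<in> sphere 0 1 \<Longrightarrow> has_sphere_gradient (u t) (sphere_gradient (u t) \<eta>) \<eta>"
      "\<And>t \<eta> x. t \<ge> 0 \<Longrightarrow> \<eta> \<in> sphere 0 1 \<Longrightarrow> sphere_gradient (u t) \<eta> \<bullet> x = u' (t, \<eta>) (0, x)"
    by (rule homogeneous_total_derivative) (assumption | blast)+
  note grad = grads[OF t \<eta>]
  define \<Gamma> where "\<Gamma> = inv_depth S C q t \<eta>"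
  define M where "M = scene_point t \<eta>"
  define y where "y s = \<Gamma> *\<^sub>R pixel s M" for s
  define w where "w = cross3 \<eta> (\<omega> t) - \<Gamma> *\<^sub>R v t"
  define g where "g = sphere_gradient (u t) \<eta>"
  have yt: "y t = \<eta>" and y': "(y has_vector_derivative w) (at t within {0..})"
    using pixel_characteristic[OF t \<eta>] by (simp_all add: y_def[abs_def] w_def \<Gamma>_def M_def)
  have "M \<in> S" using scene_point_in_S[OF t sphere_nonzero[OF \<eta>]] by (simp add: M_def)
  moreover have "\<Gamma> \<noteq> 0" using yt sphere_nonzero[OF \<eta>] by (auto simp: y_def)
  ultimately have ynz: "y s \<noteq> 0" if "s \<ge> 0" for s using pixel_nonzero[OF that] by (simp add: y_def)
  have lin: "linear (u' (t, \<eta>))"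
    using u'[OF t \<eta>] by (simp add: has_derivative_bounded_linear bounded_linear.linear)
  have "((\<lambda>s. (s, y s)) has_derivative (\<lambda>h. (h, h *\<^sub>R w))) (at t within {0..})"
    using y' by (auto simp: has_vector_derivative_def intro!: derivative_eq_intros)
  moreover have "((\<lambda>z. u (fst z) (snd z)) has_derivative u' (t, \<eta>)) (at (t, y t) within (\<lambda>s. (s, y s)) ` {0..})"
    unfolding yt by (rule has_derivative_subset[OF u'[OF t \<eta>]]) (use ynz in auto)
  ultimately have "((\<lambda>s. u s (y s)) has_derivative (\<lambda>h. u' (t, \<eta>) (h, h *\<^sub>R w))) (at t within {0..})"
    using has_derivative_in_compose[of "\<lambda>s. (s, y s)" "\<lambda>h. (h, h *\<^sub>R w)" t "{0..}"
        "\<lambda>z. u (fst z) (snd z)" "u' (t, \<eta>)"] by simp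
  moreover have "u' (t, \<eta>) (h, h *\<^sub>R w) = h *\<^sub>R u' (t, \<eta>) (1, w)" for h
    using linear_scale[OF lin, of h "(1, w)"] by simp
  ultimately have "((\<lambda>s. u s (y s)) has_vector_derivative u' (t, \<eta>) (1, w)) (at t within {0..})"
    by (simp add: has_vector_derivative_def)
  moreover have "((\<lambda>s. u s (y s)) has_vector_derivative r) (at t within {0..})"
    using along by (simp add: y_def \<Gamma>_def M_def has_real_derivative_iff_has_vector_derivative)
  ultimately have r: "u' (t, \<eta>) (1, w) = r"
    using vector_derivative_unique_within[OF at_within_Ici_neq_bot[OF t]] by blast
  have "u' (t, \<eta>) (1, w) = u' (t, \<eta>) (1, 0) + u' (t, \<eta>) (0, w)"
    using linear_add[OF lin, of "(1, 0)" "(0, w)"] by simp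
  then have time: "u' (t, \<eta>) (1, 0) = r - g \<bullet> w" using r grad(2) by (simp add: g_def)
  \<comment> \<open>The double cross product is minus the tangential part of v; it matches -v up to
    a multiple of \<open>\<eta>\<close>.\<close>
  have "flow_g v t \<eta> = (\<eta> \<bullet> v t) *\<^sub>R \<eta> - (\<eta> \<bullet> \<eta>) *\<^sub>R v t"
    by (simp add: flow_g_def cross3_simps forall_3)
  moreover have "\<eta> \<bullet> \<eta> = 1" using \<eta> by (simp add: norm_eq_1)
  moreover have "g \<bullet> \<eta> = 0" using grad(1) by (simp add: has_sphere_gradient_def g_def)
  ultimately have "g \<bullet> w = g \<bullet> (flow_f \<omega> t \<eta> + \<Gamma> *\<^sub>R flow_g v t \<eta>)"
    by (simp add: w_def flow_f_def inner_diff_right inner_add_right)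
  with time have val: "u' (t, \<eta>) (1, 0) = r - g \<bullet> (flow_f \<omega> t \<eta> + \<Gamma> *\<^sub>R flow_g v t \<eta>)" by simp
  have "((\<lambda>s. (s, \<eta>)) has_derivative (\<lambda>h. (h, 0))) (at t within {0..})"
    by (auto intro!: derivative_eq_intros)
  moreover have "((\<lambda>z. u (fst z) (snd z)) has_derivative u' (t, \<eta>)) (at (t, \<eta>) within (\<lambda>s. (s, \<eta>)) ` {0..})"
    by (rule has_derivative_subset[OF u'[OF t \<eta>]]) (use sphere_nonzero[OF \<eta>] in auto)
  ultimately have "((\<lambda>s. u s \<eta>) has_derivative (\<lambda>h. u' (t, \<eta>) (h, 0))) (at t within {0..})"
    using has_derivative_in_compose[of "\<lambda>s. (s, \<eta>)" "\<lambda>h. (h, 0)" t "{0..}"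
        "\<lambda>z. u (fst z) (snd z)" "u' (t, \<eta>)"] by simp
  moreover have "u' (t, \<eta>) (h, 0) = (r - g \<bullet> (flow_f \<omega> t \<eta> + \<Gamma> *\<^sub>R flow_g v t \<eta>)) * h" for h
    using linear_scale[OF lin, of h "(1, 0)"] val by simp
  ultimately show ?thesis by (simp add: has_field_derivative_def g_def \<Gamma>_def)
qed

end

text \<open>The decay integral follows one fixed M while its pixel moves, so the bounds over pixels
  are restated over scene points: each M is seen in some direction at every time.\<close>

lemma inv_distance_bounds:
  assumes "\<forall>t\<ge>0. \<forall>\<eta>\<in>sphere 0 1. a \<le> inv_depth S C q t \<eta> \<and> inv_depth S C q t \<eta> \<le> b"
    and t: "t \<ge> 0" and M: "M \<in> S"
  shows "a \<le> inverse (norm (M - C t))" "inverse (norm (M - C t)) \<le> b"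
proof -
  define \<eta> where "\<eta> = inverse (norm (M - C t)) *\<^sub>R pixel t M"
  have pos: "norm (M - C t) > 0" using C_not_in_S[OF t M] by simp
  have \<eta>: "\<eta> \<in> sphere 0 1" using pos norm_pixel[OF t] by (simp add: \<eta>_def)
  have "scene_point t \<eta> = M" unfolding \<eta>_def by (rule scene_point_pixel[OF t M]) (use pos in simp)
  then have "inv_depth S C q t \<eta> = inverse (norm (M - C t))" by (simp add: inv_depth_eq[OF t \<eta>])
  then show "a \<le> inverse (norm (M - C t))" "inverse (norm (M - C t)) \<le> b" using assms(1) t \<eta> by metis+
qed

end

section \<open>Construction of the solution and the decay estimate\<close>

theorem theorem2:
  fixes \<Omega> S :: "(real^3) set"
    and C v \<omega> :: "real \<Rightarrow> real^3"
    and q :: "real \<Rightarrow> quaternion"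
    and vbar \<omega>bar \<gamma>bar \<Gamma>bar k :: real
    and D0 :: "real^3 \<Rightarrow> real"
  assumes scene: "convex_scene \<Omega> S"
    and camera: "camera_motion \<Omega> C q v \<omega>"
    and pos: "vbar > 0" "\<omega>bar > 0" "\<gamma>bar > 0" "\<Gamma>bar > 0"
    and bounds: "\<forall>t\<ge>0. \<forall>\<eta>\<in>sphere 0 1. norm (v t) \<le> vbar \<and> norm (\<omega> t) \<le> \<omega>bar \<and>
           \<gamma>bar \<le> inv_depth S C q t \<eta> \<and> inv_depth S C q t \<eta> \<le> \<Gamma>bar"
    and k: "k > 0"
    and init: "C1_on (sphere 0 1) D0"
  shows "\<exists>Dh. depth_observer_solution k v \<omega> (inv_depth S C q) D0 Dh \<and>
           (\<forall>E. depth_observer_solution k v \<omega> (inv_depth S C q) D0 E \<longrightarrow>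
                (\<forall>t\<ge>0. \<forall>\<eta>\<in>sphere 0 1. E t \<eta> = Dh t \<eta>)) \<and>
           (\<forall>t\<ge>0. C1_on (sphere 0 1) (Dh t)) \<and>
           continuous_on ({0..} \<times> sphere 0 1) (\<lambda>(t, \<eta>). sphere_gradient (Dh t) \<eta>) \<and>
           (\<forall>t\<ge>0. sphere_norm_inf (\<lambda>\<eta>. Dh t \<eta> - depth S C q t \<eta>)
                   \<le> exp (- k * \<gamma>bar * t) * sphere_norm_inf (\<lambda>\<eta>. Dh 0 \<eta> - depth S C q 0 \<eta>))"
proof -
  interpret moving_camera \<Omega> S C v \<omega> q by unfold_locales (fact scene, fact camera)
  let ?X = "{0::real..} \<times> (-{0::real^3})"
  have dist: "\<gamma>bar \<le> inverse (norm (M - C t))" "inverse (norm (M - C t)) \<le> \<Gamma>bar"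
    if "t \<ge> 0" "M \<in> S" for t M
    using inv_distance_bounds[of \<gamma>bar \<Gamma>bar t M] bounds that by blast+
  \<comment> \<open>The upper bound on inverse depth keeps scene points at distance at least
    \<open>inverse \<Gamma>bar\<close>, where \<open>h\<close> is the true inverse distance.\<close>
  obtain h :: "real^3 \<Rightarrow> real" where h: "C1_within UNIV h"
    "\<And>x. norm x \<ge> inverse \<Gamma>bar \<Longrightarrow> h x = inverse (norm x)"
    using C1_inverse_norm_extension[of "inverse \<Gamma>bar"] pos by (metis positive_imp_inverse_positive)
  have h_dist: "h (M - C t) = inverse (norm (M - C t))" if "t \<ge> 0" "M \<in> S" for t M
  proof (rule h(2))
    have "norm (M - C t) > 0" using C_not_in_S[OF that] by simp
    then show "inverse \<Gamma>bar \<le> norm (M - C t)"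
      using le_imp_inverse_le[OF dist(2)[OF that]] by simp
  qed
  \<comment> \<open>The initial error at the pixel that shows M at time 0; \<open>sgn\<close>
    normalises that pixel.\<close>
  define A where "A M = D0 (sgn (pixel 0 M)) - norm (M - C 0)" for M
  define I where "I M = scaled_integral (\<lambda>s. h (M - C s))" for M
  define along where "along t M = norm (M - C t) + A M * exp (- k * I M t)" for t M
  define u where "u t \<eta> = along t (scene_point t \<eta>)" for t \<eta>
  have u_pixel: "u t (a *\<^sub>R pixel t M) = along t M" if "t \<ge> 0" "M \<in> S" "a > 0" for t M a
    by (simp add: u_def scene_point_pixel that)
  have hom: "u t (c *\<^sub>R \<eta>) = u t \<eta>" if "t \<ge> 0" "\<eta> \<noteq> 0" "c > 0" for t \<eta> c
    by (simp add: u_def scene_point_scaleR that)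
  have C1: "C1_within ?X (\<lambda>z. u (fst z) (snd z))"
  proof -
    let ?P = "\<lambda>z. scene_point (fst z) (snd z)"
    have C: "C1_within ?X (\<lambda>z. C (fst z))"
      by (rule C1_within_compose[OF C1_within_fst C1_within_C]) auto
    have inS: "?P z \<in> S" "fst z \<ge> 0" if "z \<in> ?X" for z
      using scene_point_in_S[of "fst z" "snd z"] that by (simp_all add: mem_Times_iff)
    have d: "C1_within ?X (\<lambda>z. norm (?P z - C (fst z)))"
      by (intro C1_within_norm C1_within_diff C1_within_scene_point C)
        (use inS C_not_in_S in \<open>metis right_minus_eq\<close>)
    have d0: "C1_within ?X (\<lambda>z. norm (?P z - C 0))"
      by (intro C1_within_norm C1_within_diff C1_within_scene_point C1_within_const)
        (use inS C_not_in_S[of 0] in \<open>metis order_refl right_minus_eq\<close>)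
    have "C1_within ?X (\<lambda>z. pixel 0 (?P z))"
      unfolding pixel_def
      by (intro C1_within_linear_compose[OF bounded_linear_qrot] C1_within_diff
          C1_within_scene_point C1_within_const)
    moreover have "(\<lambda>z. pixel 0 (?P z)) ` ?X \<subseteq> -{0}"
      using inS(1) pixel_nonzero[OF order_refl] by (intro image_subsetI) blast
    ultimately have D0: "C1_within ?X (\<lambda>z. D0 (sgn (pixel 0 (?P z))))"
      using C1_within_compose[OF _ C1_on_sphere_sgn[OF init]] by blast
    have "C1_within ?X (\<lambda>z. I (?P z) (fst z))"
    proof -
      have "C1_within ?X (\<lambda>z. (\<lambda>p. scaled_integral (\<lambda>s. h (snd p - C s)) (fst p)) (fst z, ?P z))"
        by (rule C1_within_compose[OF C1_within_Pair[OF C1_within_fst C1_within_scene_point]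
              C1_within_scaled_integral[OF C1_within_C h(1)]]) auto
      then show ?thesis by (simp add: I_def)
    qed
    then show ?thesis
      unfolding u_def along_def A_def
      by (intro C1_within_add C1_within_mult C1_within_exp C1_within_diff d d0 D0 C1_within_const)
  qed
  note hyps = C1 hom
  have grad: "has_sphere_gradient (u t) (sphere_gradient (u t) \<eta>) \<eta>"
    if "t \<ge> 0" "\<eta> \<in> sphere 0 1" for t \<eta>
  proof (rule homogeneous_total_derivative[OF hyps])
    assume "\<And>t \<eta>. t \<ge> 0 \<Longrightarrow> \<eta> \<in> sphere 0 1 \<Longrightarrow>
      has_sphere_gradient (u t) (sphere_gradient (u t) \<eta>) \<eta>"
    from this[OF that] show ?thesis .
  qed
  have grad_cont: "continuous_on ({0..} \<times> sphere 0 1) (\<lambda>(t, \<eta>). sphere_gradient (u t) \<eta>)"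
    by (rule homogeneous_total_derivative[OF hyps]) assumption+
  have cont: "continuous_on ({0..} \<times> sphere 0 1) (\<lambda>z. u (fst z) (snd z))"
    by (rule continuous_on_subset[OF C1_within_continuous_on[OF C1]]) auto
  have error: "u t \<eta> - depth S C q t \<eta> = A (scene_point t \<eta>) * exp (- k * I (scene_point t \<eta>) t)"
    if "t \<ge> 0" "\<eta> \<in> sphere 0 1" for t \<eta>
    by (simp add: u_def along_def depth_eq[OF that])
  have f_cont: "continuous_on {0..} (\<lambda>s. h (M - C s))" for M
    by (rule C1_within_continuous_on[OF C1_within_compose[OF C1_within_diff[OF C1_within_const C1_within_C] h(1)]]) simp
  have time: "((\<lambda>s. u s \<eta>) has_real_derivative
           - (sphere_gradient (u t) \<eta> \<bullet> (flow_f \<omega> t \<eta> + inv_depth S C q t \<eta> *\<^sub>R flow_g v t \<eta>))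
           - v t \<bullet> \<eta> + k * (1 - u t \<eta> * inv_depth S C q t \<eta>)) (at t within {0..})"
    if t: "t \<ge> 0" and \<eta>: "\<eta> \<in> sphere 0 1" for t \<eta>
  proof -
    define M where "M = scene_point t \<eta>"
    define \<Gamma> where "\<Gamma> = inv_depth S C q t \<eta>"
    define y where "y s = \<Gamma> *\<^sub>R pixel s M" for s
    have M: "M \<in> S" using scene_point_in_S[OF t sphere_nonzero[OF \<eta>]] by (simp add: M_def)
    have D: "norm (M - C t) > 0" and \<Gamma>: "\<Gamma> = inverse (norm (M - C t))"
      using depth_pos[OF t \<eta>] inv_depth_eq[OF t \<eta>] by (simp_all add: M_def \<Gamma>_def)
    then have \<Gamma>pos: "\<Gamma> > 0" by simp
    have yt: "y t = \<eta>" and y': "(y has_vector_derivative cross3 \<eta> (\<omega> t) - \<Gamma> *\<^sub>R v t) (at t within {0..})"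
      using pixel_characteristic[OF t \<eta>] by (simp_all add: y_def[abs_def] \<Gamma>_def M_def)
    \<comment> \<open>On the curve \<open>norm (y s)\<close> is \<open>\<Gamma>\<close> times the
      distance from C s to M. Since \<open>y t\<close> is a unit vector, the norm has derivative
      \<open>x \<bullet> \<eta>\<close>, and the rotational part of the velocity is orthogonal to
      \<open>\<eta>\<close>.\<close>
    have "(norm has_derivative (\<lambda>x. x \<bullet> \<eta>)) (at (y t))"
      using has_derivative_norm[of \<eta>] sphere_nonzero[OF \<eta>] \<eta> yt by (simp add: sgn_div_norm)
    from has_derivative_compose[OF y'[unfolded has_vector_derivative_def] this]
    have "((\<lambda>s. norm (y s)) has_derivative
        (\<lambda>x. (x *\<^sub>R (cross3 \<eta> (\<omega> t) - \<Gamma> *\<^sub>R v t)) \<bullet> \<eta>)) (at t within {0..})" .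
    moreover have "(x *\<^sub>R (cross3 \<eta> (\<omega> t) - \<Gamma> *\<^sub>R v t)) \<bullet> \<eta> = - (\<Gamma> * (v t \<bullet> \<eta>)) * x" for x
      by (simp add: inner_diff_left dot_cross_self)
    ultimately have "((\<lambda>s. norm (y s)) has_real_derivative - (\<Gamma> * (v t \<bullet> \<eta>))) (at t within {0..})"
      by (simp only: has_field_derivative_def)
    then have "((\<lambda>s. inverse \<Gamma> * norm (y s)) has_real_derivative - (v t \<bullet> \<eta>)) (at t within {0..})"
      using \<Gamma>pos by (auto intro!: derivative_eq_intros)
    then have dn: "((\<lambda>s. norm (M - C s)) has_real_derivative - (v t \<bullet> \<eta>)) (at t within {0..})"
      by (rule has_field_derivative_transform_within[OF _ zero_less_one])
        (use t \<Gamma>pos in \<open>auto simp: y_def norm_pixel\<close>)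
    have "(I M has_real_derivative h (M - C t)) (at t within {0..})"
      unfolding I_def by (rule scaled_integral_has_real_derivative[OF f_cont t])
    then have "((\<lambda>s. along s M) has_real_derivative
        - (v t \<bullet> \<eta>) + A M * (exp (- k * I M t) * (- k * \<Gamma>))) (at t within {0..})"
      unfolding along_def h_dist[OF t M] \<Gamma>[symmetric]
      by (auto intro!: derivative_eq_intros dn)
    then have "((\<lambda>s. u s (y s)) has_real_derivative
        - (v t \<bullet> \<eta>) + A M * (exp (- k * I M t) * (- k * \<Gamma>))) (at t within {0..})"
      by (rule has_field_derivative_transform_within[OF _ zero_less_one])
        (use t \<Gamma>pos M in \<open>auto simp: y_def u_pixel\<close>)
    from time_derivative_from_characteristic[OF hyps t \<eta> this[unfolded y_def \<Gamma>_def M_def]]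
    have "((\<lambda>s. u s \<eta>) has_real_derivative
        - (v t \<bullet> \<eta>) + A M * (exp (- k * I M t) * (- k * \<Gamma>)) -
        sphere_gradient (u t) \<eta> \<bullet> (flow_f \<omega> t \<eta> + \<Gamma> *\<^sub>R flow_g v t \<eta>)) (at t within {0..})"
      by (simp add: \<Gamma>_def M_def)
    \<comment> \<open>True depth times \<open>\<Gamma>\<close> is 1, so the observer correction sees
      only the error term.\<close>
    moreover have "A M * (exp (- k * I M t) * (- k * \<Gamma>)) = k * (1 - u t \<eta> * \<Gamma>)"
    proof -
      have "norm (M - C t) * \<Gamma> = 1" using D \<Gamma> by simp
      moreover have "u t \<eta> = norm (M - C t) + A M * exp (- k * I M t)"
        by (simp add: u_def along_def M_def)
      ultimately show ?thesis by (simp add: distrib_right)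
    qed
    ultimately show ?thesis unfolding \<Gamma>_def by (elim DERIV_cong) simp
  qed
  have initial: "u 0 \<eta> = D0 \<eta>" if "\<eta> \<in> sphere 0 1" for \<eta>
  proof -
    have nz: "\<eta> \<noteq> 0" using sphere_nonzero[OF that] .
    have "sgn (pixel 0 (scene_point 0 \<eta>)) = \<eta>"
      using pixel_scene_point[OF order_refl nz] depth_pos[OF order_refl that] that
      by (simp add: sgn_scaleR sgn_div_norm)
    then show ?thesis by (simp add: u_def along_def A_def I_def scaled_integral_def)
  qed
  have sol: "depth_observer_solution k v \<omega> (inv_depth S C q) D0 u"
    unfolding depth_observer_solution_def
  proof (intro conjI ballI allI impI)
    show "continuous_on ({0..} \<times> sphere 0 1) (\<lambda>(t, \<eta>). u t \<eta>)"
      using cont by (simp add: case_prod_unfold)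
    show "\<exists>g. has_sphere_gradient (u t) g \<eta>" if "t \<ge> 0" "\<eta> \<in> sphere 0 1" for t \<eta>
      using grad[OF that] by blast
  qed (fact initial time)+
  moreover have "E t \<eta> = u t \<eta>"
    if "depth_observer_solution k v \<omega> (inv_depth S C q) D0 E" "t \<ge> 0" "\<eta> \<in> sphere 0 1" for E t \<eta>
  proof -
    have "inv_depth S C q s x \<ge> 0" for s x by (simp add: inv_depth_def depth_def)
    then show ?thesis
      using depth_observer_solution_le[OF that(1) sol _ _ that(2,3)]
        depth_observer_solution_le[OF sol that(1) _ _ that(2,3)] k by fastforce
  qed
  moreover have "C1_on (sphere 0 1) (u t)" if "t \<ge> 0" for t
    by (rule homogeneous_C1_on_sphere[OF hyps that])
  moreover have "sphere_norm_inf (\<lambda>\<eta>. u t \<eta> - depth S C q t \<eta>)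
      \<le> exp (- k * \<gamma>bar * t) * sphere_norm_inf (\<lambda>\<eta>. u 0 \<eta> - depth S C q 0 \<eta>)" if t: "t \<ge> 0" for t
  proof (rule sphere_norm_inf_le)
    fix \<eta> :: "real^3" assume \<eta>: "\<eta> \<in> sphere 0 1"
    define M where "M = scene_point t \<eta>"
    have M: "M \<in> S" using scene_point_in_S[OF t sphere_nonzero[OF \<eta>]] by (simp add: M_def)
    \<comment> \<open>The pixel at which the same M was seen at time 0; the error at (t,
      \<open>\<eta>\<close>) is the initial error there, damped.\<close>
    define \<eta>0 where "\<eta>0 = inverse (norm (M - C 0)) *\<^sub>R pixel 0 M"
    have "norm (M - C 0) > 0" using C_not_in_S[OF order_refl M] by simp
    then have \<eta>0: "\<eta>0 \<in> sphere 0 1" "scene_point 0 \<eta>0 = M"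
      using norm_pixel[OF order_refl] scene_point_pixel[OF order_refl M] by (auto simp: \<eta>0_def)
    \<comment> \<open>Continuity makes the supremum finite, so that it dominates the value at
      \<open>\<eta>0\<close>.\<close>
    have cont0: "continuous_on (sphere 0 1) (\<lambda>\<eta>. u 0 \<eta> - depth S C q 0 \<eta>)"
    proof -
      have P: "(\<lambda>\<eta>. (0, \<eta>)) ` sphere (0::real^3) 1 \<subseteq> ?X" "continuous_on (sphere (0::real^3) 1) (\<lambda>\<eta>. (0::real, \<eta>))"
        by (auto intro!: continuous_intros)
      have "continuous_on (sphere 0 1) (scene_point 0)" "continuous_on (sphere 0 1) (u 0)"
        using continuous_on_compose2[OF C1_within_continuous_on[OF C1_within_scene_point] P(2,1)]
          continuous_on_compose2[OF C1_within_continuous_on[OF C1] P(2,1)] by simp_all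
      then have "continuous_on (sphere 0 1) (\<lambda>\<eta>. u 0 \<eta> - norm (scene_point 0 \<eta> - C 0))"
        by (intro continuous_intros)
      then show ?thesis by (rule continuous_on_eq) (simp add: depth_eq)
    qed
    have "I M 0 = 0" by (simp add: I_def scaled_integral_def)
    then have "\<bar>A M\<bar> \<le> sphere_norm_inf (\<lambda>\<eta>. u 0 \<eta> - depth S C q 0 \<eta>)"
      using sphere_norm_inf_bound[OF cont0 \<eta>0(1)] error[OF order_refl \<eta>0(1)] \<eta>0(2) by simp
    moreover have "\<gamma>bar * t \<le> I M t"
    proof -
      have "integral {0..t} (\<lambda>_. \<gamma>bar) \<le> integral {0..t} (\<lambda>s. h (M - C s))"
        by (intro integral_le integrable_continuous_real continuous_on_subset[OF f_cont])
          (use dist(1) h_dist M in auto)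
      then show ?thesis using t by (simp add: I_def scaled_integral_eq[OF f_cont] mult.commute)
    qed
    then have "exp (- k * I M t) \<le> exp (- k * \<gamma>bar * t)" using k by simp
    ultimately have "\<bar>A M\<bar> * exp (- k * I M t)
        \<le> sphere_norm_inf (\<lambda>\<eta>. u 0 \<eta> - depth S C q 0 \<eta>) * exp (- k * \<gamma>bar * t)"
      by (intro mult_mono) auto
    then show "\<bar>u t \<eta> - depth S C q t \<eta>\<bar>
        \<le> exp (- k * \<gamma>bar * t) * sphere_norm_inf (\<lambda>\<eta>. u 0 \<eta> - depth S C q 0 \<eta>)"
      by (simp add: error[OF t \<eta>] M_def[symmetric] abs_mult mult.commute)
  qed
  ultimately show ?thesis using grad_cont by (intro exI[of _ u]) blast
qed

end
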